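(* Let $\mathcal{A}\in\mathbb{C}^{n\times n\times p}$ be a complex tensor with T-Jordan canonical form $\mathcal{A}=\mathcal{P}^{-1}*\mathcal{J}*\mathcal{P}$, and let $k=\mathrm{Ind}_T(\mathcal{A})$. Write $$\mathrm{bcirc}(\mathcal{J})=(F_p^H\otimes I_n)\,\mathrm{diag}(J_1,J_2,\dots,J_p)\,(F_p\otimes I_n),$$ where each block $J_i$ is partitioned as $J_i=\begin{bmatrix}J_i^{1}&0\\0&J_i^{0}\end{bmatrix}$ with $J_i^1$ nonsingular (the part with non-zero eigenvalues) and $J_i^0$ nilpotent (the part with zero eigenvalues). Put $J_i^D=\begin{bmatrix}(J_i^{1})^{-1}&0\\0&0\end{bmatrix}$ (the Drazin inverse of the matrix $J_i$) and define $\mathcal{J}^D$ by $$\mathrm{bcirc}(\mathcal{J}^D)=(F_p^H\otimes I_n)\,\mathrm{diag}(J_1^D,J_2^D,\dots,J_p^D)\,(F_p\otimes I_n).$$ Then the T-Drazin inverse of $\mathcal{A}$ is given by $$\mathcal{A}^D=\mathcal{P}^{-1}*\mathcal{J}^D*\mathcal{P}.$$ It is the unique solution $\mathcal{X}$ of the three equations $$\mathcal{A}^k*\mathcal{X}*\mathcal{A}=\mathcal{A}^k,\qquad \mathcal{X}*\mathcal{A}*\mathcal{X}=\mathcal{X},\qquad \mathcal{A}*\mathcal{X}=\mathcal{X}*\mathcal{A},$$ and the T-group inverse is the particular case of the T-Drazin inverse for tensors with T-index $1$.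
   Context: For $\mathcal{A}\in\mathbb{C}^{m\times n\times p}$ let $A^{(1)},\dots,A^{(p)}\in\mathbb{C}^{m\times n}$ be its frontal slices. $\mathrm{bcirc}(\mathcal{A})$ is the $mp\times np$ block circulant matrix whose $(i,j)$ block ($1\le i,j\le p$) is $A^{(((i-j)\bmod p)+1)}$; $\mathrm{unfold}(\mathcal{A})$ is the $mp\times n$ matrix obtained by stacking $A^{(1)},\dots,A^{(p)}$ vertically, and $\mathrm{fold}$ is the inverse of $\mathrm{unfold}$. The T-product is $\mathcal{A}*\mathcal{B}=\mathrm{fold}(\mathrm{bcirc}(\mathcal{A})\,\mathrm{unfold}(\mathcal{B}))$. Powers and inverses are with respect to $*$ and the identity tensor $\mathcal{I}$ (first frontal slice $I_n$, other slices zero). $F_p$ is the unitary $p\times p$ discrete Fourier matrix with entries $\frac1{\sqrt p}\omega^{(j-1)(k-1)}$, $\omega=e^{-2\pi\mathbf{i}/p}$. The index $\mathrm{Ind}(A)$ of a square matrix $A$ is the smallest positive integer $k$ with $\mathrm{rank}(A^k)=\mathrm{rank}(A^{k+1})$, and $\mathrm{Ind}_T(\mathcal{A})=\mathrm{Ind}(\mathrm{bcirc}(\mathcal{A}))$. A T-Jordan canonical form $\mathcal{A}=\mathcal{P}^{-1}*\mathcal{J}*\mathcal{P}$ is obtained by block-diagonalizing $\mathrm{bcirc}(\mathcal{A})$ by the Fourier matrix and taking the Jordan canonical form of each diagonal block: $\mathcal{P}$ is invertible and the matrices $J_1,\dots,J_p\in\mathbb{C}^{n\times n}$ are in Jordan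 canonical form, with Jordan blocks ordered so that those with non-zero eigenvalue come first. The T-Drazin inverse $\mathcal{A}^D$ is the tensor $\mathcal{X}$ satisfying the three displayed equations with $k=\mathrm{Ind}_T(\mathcal{A})$. The T-group inverse is the tensor $\mathcal{X}$ satisfying $\mathcal{A}*\mathcal{X}*\mathcal{A}=\mathcal{A}$, $\mathcal{X}*\mathcal{A}*\mathcal{X}=\mathcal{X}$, $\mathcal{A}*\mathcal{X}=\mathcal{X}*\mathcal{A}$. *)

theory Defs
  imports
    "Jordan_Normal_Form.Jordan_Normal_Form"
    "Jordan_Normal_Form.Gauss_Jordan_Elimination"
    "Jordan_Normal_Form.Schur_Decomposition"
    "Jordan_Normal_Form.DL_Rank"
begin

definition kronecker :: "complex mat \<Rightarrow> complex mat \<Rightarrow> complex mat" (infixl "\<otimes>\<^sub>K" 70) where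
  "A \<otimes>\<^sub>K B = mat (dim_row A * dim_row B) (dim_col A * dim_col B)
     (\<lambda>(i, j). A $$ (i div dim_row B, j div dim_col B) * B $$ (i mod dim_row B, j mod dim_col B))"

definition dft_mat :: "nat \<Rightarrow> complex mat" where
  "dft_mat p = mat p p (\<lambda>(j, k).
     exp (- (2 * of_real pi * \<i> / of_nat p)) ^ (j * k) / of_real (sqrt (real p)))"

definition fourier_block_diag :: "nat \<Rightarrow> nat \<Rightarrow> (nat \<Rightarrow> complex mat) \<Rightarrow> complex mat" where
  "fourier_block_diag n p D =
     (mat_adjoint (dft_mat p) \<otimes>\<^sub>K 1\<^sub>m n) * diag_block_mat (map D [0..<p]) * (dft_mat p \<otimes>\<^sub>K 1\<^sub>m n)"

definition mat_index :: "complex mat \<Rightarrow> nat" where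
  "mat_index A = (LEAST k. 0 < k \<and>
     vec_space.rank (dim_row A) (A ^\<^sub>m k) = vec_space.rank (dim_row A) (A ^\<^sub>m (k + 1)))"

definition is_mat_drazin_inverse :: "complex mat \<Rightarrow> complex mat \<Rightarrow> bool" where
  "is_mat_drazin_inverse A X \<longleftrightarrow>
     X \<in> carrier_mat (dim_row A) (dim_row A) \<and>
     A ^\<^sub>m mat_index A * X * A = A ^\<^sub>m mat_index A \<and> X * A * X = X \<and> A * X = X * A"

definition nilpotent_mat :: "complex mat \<Rightarrow> bool" where
  "nilpotent_mat A \<longleftrightarrow> square_mat A \<and> (\<exists>m. A ^\<^sub>m m = 0\<^sub>m (dim_row A) (dim_row A))"

text \<open>A matrix that itself is in Jordan canonical form (not merely similar to one), in which no
  block with eigenvalue zero precedes a block with non-zero eigenvalue.\<close>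

definition ordered_jordan :: "nat \<Rightarrow> complex mat \<Rightarrow> bool" where
  "ordered_jordan n M \<longleftrightarrow> M \<in> carrier_mat n n \<and>
     (\<exists>n_as. 0 \<notin> fst ` set n_as \<and> M = jordan_matrix n_as \<and>
        sorted_wrt (\<lambda>x y. snd y \<noteq> 0 \<longrightarrow> snd x \<noteq> 0) n_as)"

definition block_diag2 :: "complex mat \<Rightarrow> complex mat \<Rightarrow> complex mat" where
  "block_diag2 B C =
     four_block_mat B (0\<^sub>m (dim_row B) (dim_col C)) (0\<^sub>m (dim_row C) (dim_col B)) C"

definition core_nilpotent_partition :: "complex mat \<Rightarrow> complex mat \<Rightarrow> complex mat \<Rightarrow> bool" where
  "core_nilpotent_partition M B C \<longleftrightarrow>
     M = block_diag2 B C \<and> invertible_mat B \<and> nilpotent_mat C"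

definition partition_drazin :: "complex mat \<Rightarrow> complex mat \<Rightarrow> complex mat" where
  "partition_drazin B C = block_diag2 (the (mat_inverse B)) (0\<^sub>m (dim_row C) (dim_col C))"

text \<open>An \<open>m \<times> n \<times> p\<close> tensor is the list of its \<open>p\<close> frontal slices. Slices and matrix entries are
  indexed from 0, so the slice with list index \<open>k\<close> is the one usually numbered \<open>k + 1\<close>.\<close>

type_synonym ctensor = "complex mat list"

definition tensors :: "nat \<Rightarrow> nat \<Rightarrow> nat \<Rightarrow> ctensor set" where
  "tensors m n p = {A. length A = p \<and> set A \<subseteq> carrier_mat m n}"

text \<open>The row and column numbers are read off the first slice; they are meaningful only for \<open>p > 0\<close>.\<close>

definition t_rows :: "ctensor \<Rightarrow> nat" where
  "t_rows A = dim_row (hd A)"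

definition t_cols :: "ctensor \<Rightarrow> nat" where
  "t_cols A = dim_col (hd A)"

definition bcirc :: "ctensor \<Rightarrow> complex mat" where
  "bcirc A = (let m = t_rows A; n = t_cols A; p = length A in
     mat (m * p) (n * p) (\<lambda>(i, j).
       (A ! nat ((int (i div m) - int (j div n)) mod int p)) $$ (i mod m, j mod n)))"

definition unfold :: "ctensor \<Rightarrow> complex mat" where
  "unfold A = (let m = t_rows A in
     mat (m * length A) (t_cols A) (\<lambda>(i, j). (A ! (i div m)) $$ (i mod m, j)))"

definition fold_tensor :: "nat \<Rightarrow> complex mat \<Rightarrow> ctensor" where
  "fold_tensor p M = (let m = dim_row M div p in
     map (\<lambda>k. mat m (dim_col M) (\<lambda>(i, j). M $$ (k * m + i, j))) [0..<p])"

definition t_mult :: "ctensor \<Rightarrow> ctensor \<Rightarrow> ctensor" (infixl "\<star>" 70) where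
  "A \<star> B = fold_tensor (length A) (bcirc A * unfold B)"

definition t_one :: "nat \<Rightarrow> nat \<Rightarrow> ctensor" where
  "t_one n p = map (\<lambda>k. if k = 0 then 1\<^sub>m n else 0\<^sub>m n n) [0..<p]"

primrec t_pow :: "ctensor \<Rightarrow> nat \<Rightarrow> ctensor" where
  "t_pow A 0 = t_one (t_rows A) (length A)"
| "t_pow A (Suc k) = t_pow A k \<star> A"

definition is_t_inverse :: "ctensor \<Rightarrow> ctensor \<Rightarrow> bool" where
  "is_t_inverse A X \<longleftrightarrow> (let n = t_rows A; p = length A in
     A \<in> tensors n n p \<and> X \<in> tensors n n p \<and> A \<star> X = t_one n p \<and> X \<star> A = t_one n p)"

definition t_invertible :: "ctensor \<Rightarrow> bool" where
  "t_invertible A \<longleftrightarrow> (\<exists>X. is_t_inverse A X)"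

definition t_inverse :: "ctensor \<Rightarrow> ctensor" where
  "t_inverse A = (THE X. is_t_inverse A X)"

definition t_index :: "ctensor \<Rightarrow> nat" where
  "t_index A = mat_index (bcirc A)"

definition is_t_drazin_inverse :: "ctensor \<Rightarrow> ctensor \<Rightarrow> bool" where
  "is_t_drazin_inverse A X \<longleftrightarrow>
     X \<in> tensors (t_rows A) (t_rows A) (length A) \<and>
     t_pow A (t_index A) \<star> X \<star> A = t_pow A (t_index A) \<and> X \<star> A \<star> X = X \<and> A \<star> X = X \<star> A"

definition t_drazin_inverse :: "ctensor \<Rightarrow> ctensor" where
  "t_drazin_inverse A = (THE X. is_t_drazin_inverse A X)"

definition is_t_group_inverse :: "ctensor \<Rightarrow> ctensor \<Rightarrow> bool" where
  "is_t_group_inverse A X \<longleftrightarrow>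
     X \<in> tensors (t_rows A) (t_rows A) (length A) \<and>
     A \<star> X \<star> A = A \<and> X \<star> A \<star> X = X \<and> A \<star> X = X \<star> A"

text \<open>Only \<open>J\<close> needs an explicit Fourier block-diagonalization: every block circulant matrix has
  one, so those of \<open>A\<close> and \<open>P\<close> exist automatically, and \<open>A = P\<^sup>-\<^sup>1 \<star> J \<star> P\<close> says slice by slice in
  the Fourier domain that the \<open>i\<close>-th diagonal block of \<open>A\<close> has the Jordan form \<open>Js i\<close>.\<close>

definition t_jordan_form ::
    "nat \<Rightarrow> nat \<Rightarrow> ctensor \<Rightarrow> ctensor \<Rightarrow> ctensor \<Rightarrow> (nat \<Rightarrow> complex mat) \<Rightarrow> bool" where
  "t_jordan_form n p A P J Js \<longleftrightarrow>
     P \<in> tensors n n p \<and> J \<in> tensors n n p \<and> t_invertible P \<and>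
     A = t_inverse P \<star> J \<star> P \<and>
     bcirc J = fourier_block_diag n p Js \<and>
     (\<forall>i<p. ordered_jordan n (Js i))"

end

theory Submission
  imports Defs
begin

text \<open>
The map \<open>bcirc\<close> embeds the \<open>n \<times> n \<times> p\<close> tensors with the T-product into the complex
\<open>np \<times> np\<close> matrices: it is injective and multiplicative and sends the identity tensor to the
identity matrix (\<open>bcirc_inject\<close>, \<open>bcirc_mult\<close>, \<open>bcirc_one\<close>). The T-Drazin equations for \<open>A\<close> are
therefore the Drazin equations for the matrix \<open>bcirc A\<close> (\<open>t_drazin_equations_iff\<close>), and
uniqueness is a short computation valid in every monoid (\<open>drazin_unique\<close>): \<open>ax\<close> and \<open>ay\<close> are
both idempotents that split off the same stable part of \<open>a\<close>.

For existence, \<open>bcirc A\<close> is similar, via \<open>bcirc P\<close> and the Fourier matrix, to the block diagonal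
matrix of the \<open>J\<^sub>i\<close>. Drazin equations hold block by block and survive similarity. For
\<open>J\<^sub>i = diag(B, C)\<close> with \<open>B\<close> invertible and \<open>C ^ m = 0\<close> they are immediate for
\<open>diag(B\<^sup>-\<^sup>1, 0)\<close> at the exponent \<open>m\<close>, and one exponent can serve all blocks, since enlarging it is
harmless (\<open>mat_drazin_add_exponent\<close>).

This yields the equations at some exponent, while the theorem asks for them at the index. The
link is \<open>mat_drazin_rank_stable\<close>. If \<open>rank (M ^ k) = rank (M ^ (k + 1))\<close>, the two column spaces
coincide, so \<open>M ^ k = M ^ (k + 1) * Z\<close> for some \<open>Z\<close>; iterating, \<open>M ^ k\<close> has \<open>M ^ m\<close> as a left factor
for every \<open>m\<close>, and the equation at \<open>m\<close> passes to \<open>k\<close>. The statement on the group inverse follows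
as well: equations that hold at exponent 1 make the ranks of \<open>M\<close> and \<open>M ^ 2\<close> equal, so the index
is 1.

That a tensor \<open>J\<^sup>D\<close> exists at all is the converse half of Fourier block diagonalization: the
\<open>(a, b)\<close> block of \<open>(F\<^sup>H \<otimes> I) diag(D\<^sub>1, \<dots>, D\<^sub>p) (F \<otimes> I)\<close> is
\<open>1/p \<Sum>\<^sub>c \<omega>\<^bsup>c(b - a)\<^esup> D\<^sub>c\<close> with \<open>\<omega> = exp (-2\<pi>\<i>/p)\<close>, which depends only on
\<open>a - b\<close> modulo \<open>p\<close> (\<open>fourier_block_diag_is_bcirc\<close>).
\<close>

section \<open>Drazin inverses in a monoid\<close>

context monoid
begin

text \<open>The exponent is a parameter instead of being tied to an index. Thus the equations can be
verified at whichever exponent is convenient and moved to the index afterwards.\<close>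

definition drazin :: "nat \<Rightarrow> 'a \<Rightarrow> 'a \<Rightarrow> bool" where
  "drazin m a x \<longleftrightarrow> a \<in> carrier G \<and> x \<in> carrier G \<and>
     a [^] m \<otimes> x \<otimes> a = a [^] m \<and> x \<otimes> a \<otimes> x = x \<and> a \<otimes> x = x \<otimes> a"

lemma commute_pow:
  assumes "a \<in> carrier G" "x \<in> carrier G" "a \<otimes> x = x \<otimes> a"
  shows "a [^] (m::nat) \<otimes> x = x \<otimes> a [^] m"
proof (induction m)
  case 0
  then show ?case using assms by simp
next
  case (Suc m)
  have "a [^] Suc m \<otimes> x = a [^] m \<otimes> (x \<otimes> a)"
    using assms by (simp add: m_assoc)
  also have "\<dots> = x \<otimes> a [^] Suc m"
    using assms Suc by (simp flip: m_assoc)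
  finally show ?case .
qed

lemma commute_mult:
  assumes "a \<in> carrier G" "x \<in> carrier G" "a \<otimes> x = x \<otimes> a"
  shows "a \<otimes> (a \<otimes> x) = a \<otimes> x \<otimes> a"
proof -
  have "a \<otimes> (a \<otimes> x) = a \<otimes> (x \<otimes> a)"
    using assms by simp
  also have "\<dots> = a \<otimes> x \<otimes> a"
    using assms(1,2) by (simp add: m_assoc)
  finally show ?thesis .
qed

lemma drazin_pow_mult:
  assumes "drazin m a x"
  shows "(a \<otimes> x) \<otimes> a [^] m = a [^] m" "a [^] m \<otimes> (a \<otimes> x) = a [^] m"
proof -
  have c: "a \<in> carrier G" "x \<in> carrier G" and ax: "a \<otimes> x = x \<otimes> a"
    and e: "a [^] m \<otimes> x \<otimes> a = a [^] m"
    using assms by (auto simp: drazin_def)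
  show 1: "a [^] m \<otimes> (a \<otimes> x) = a [^] m"
    using c e ax by (simp add: m_assoc)
  show "(a \<otimes> x) \<otimes> a [^] m = a [^] m"
    using commute_pow[of a "a \<otimes> x" m] commute_mult[OF c ax] 1 c by simp
qed

text \<open>As \<open>ax\<close> is idempotent and \<open>a\<close> commutes with \<open>x\<close>, we have \<open>ax = (ax) ^ m ax = a ^ m x ^ m ax\<close>.
The factor \<open>a ^ m\<close> is split off on the left and on the right, because \<open>drazin_unique\<close> absorbs the
idempotent of one Drazin inverse into that of the other from either side.\<close>

lemma drazin_projection_pow:
  assumes "drazin m a x"
  shows "a \<otimes> x = a [^] m \<otimes> (x [^] m \<otimes> (a \<otimes> x))"
    and "a \<otimes> x = (a \<otimes> x \<otimes> x [^] m) \<otimes> a [^] m"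
proof -
  have c: "a \<in> carrier G" "x \<in> carrier G" and ax: "a \<otimes> x = x \<otimes> a"
    and xax: "x \<otimes> a \<otimes> x = x"
    using assms by (auto simp: drazin_def)
  have *: "a [^] j \<otimes> (x [^] j \<otimes> (a \<otimes> x)) = a \<otimes> x" for j :: nat
  proof (induction j)
    case 0
    then show ?case using c by simp
  next
    case (Suc j)
    have "a [^] Suc j \<otimes> (x [^] Suc j \<otimes> (a \<otimes> x))
        = a [^] j \<otimes> (a \<otimes> (x [^] Suc j \<otimes> (a \<otimes> x)))"
      using c by (simp add: m_assoc)
    also have "\<dots> = a [^] j \<otimes> (a \<otimes> (x [^] j \<otimes> (x \<otimes> a \<otimes> x)))"
      using c by (simp add: m_assoc)
    also have "\<dots> = a [^] j \<otimes> (a \<otimes> x [^] j \<otimes> x)"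
      using c xax by (simp add: m_assoc)
    also have "a \<otimes> x [^] j = x [^] j \<otimes> a"
      using commute_pow[of x a j] c ax by simp
    also have "a [^] j \<otimes> (x [^] j \<otimes> a \<otimes> x) = a [^] j \<otimes> (x [^] j \<otimes> (a \<otimes> x))"
      using c by (simp add: m_assoc)
    finally show ?case using Suc by simp
  qed
  show 1: "a \<otimes> x = a [^] m \<otimes> (x [^] m \<otimes> (a \<otimes> x))"
    using *[of m] by simp
  let ?e = "a \<otimes> x"
  have cx: "?e \<otimes> x [^] m = x [^] m \<otimes> ?e"
    using commute_pow[of x "?e" m] commute_mult[of x a] c ax by simp
  have xa: "x [^] m \<otimes> a = a \<otimes> x [^] m"
    using commute_pow[of x a m] c ax by simp
  have "a \<otimes> (?e \<otimes> x [^] m) = a \<otimes> ?e \<otimes> x [^] m"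
    using c by (simp add: m_assoc)
  also have "\<dots> = ?e \<otimes> a \<otimes> x [^] m"
    by (simp only: commute_mult[OF c ax])
  also have "\<dots> = ?e \<otimes> x [^] m \<otimes> a"
    using xa c by (simp add: m_assoc)
  finally have "a [^] m \<otimes> (?e \<otimes> x [^] m) = (?e \<otimes> x [^] m) \<otimes> a [^] m"
    using c by (intro commute_pow) auto
  then show "?e = (?e \<otimes> x [^] m) \<otimes> a [^] m"
    using 1 cx by simp
qed

text \<open>Write \<open>e = ax\<close> and \<open>f = ay\<close>. As \<open>f a ^ m = a ^ m\<close> and \<open>e\<close> begins with the factor \<open>a ^ m\<close>, we get
\<open>fe = e\<close>; as \<open>a ^ m e = a ^ m\<close> and \<open>f\<close> ends with \<open>a ^ m\<close>, we get \<open>fe = f\<close>. So \<open>e = f\<close>, and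
\<open>x = xf = ey = y\<close>.\<close>

lemma drazin_unique:
  assumes "drazin m a x" "drazin m a y"
  shows "x = y"
proof -
  have c: "a \<in> carrier G" "x \<in> carrier G" "y \<in> carrier G"
    and ax: "a \<otimes> x = x \<otimes> a" and ay: "a \<otimes> y = y \<otimes> a"
    and xax: "x \<otimes> a \<otimes> x = x" and yay: "y \<otimes> a \<otimes> y = y"
    using assms by (auto simp: drazin_def)
  let ?e = "a \<otimes> x" and ?f = "a \<otimes> y"
  have "?f \<otimes> ?e = ?f \<otimes> (a [^] m \<otimes> (x [^] m \<otimes> ?e))"
    using drazin_projection_pow(1)[OF assms(1)] by simp
  also have "\<dots> = (?f \<otimes> a [^] m) \<otimes> (x [^] m \<otimes> ?e)"
    using c by (simp add: m_assoc)
  also have "\<dots> = ?e"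
    using drazin_pow_mult(1)[OF assms(2)] drazin_projection_pow(1)[OF assms(1)] by simp
  finally have 1: "?f \<otimes> ?e = ?e" .
  have "?f \<otimes> ?e = ((?f \<otimes> y [^] m) \<otimes> a [^] m) \<otimes> ?e"
    using drazin_projection_pow(2)[OF assms(2)] by simp
  also have "\<dots> = (?f \<otimes> y [^] m) \<otimes> (a [^] m \<otimes> ?e)"
    using c by (simp add: m_assoc)
  also have "\<dots> = ?f"
    using drazin_pow_mult(2)[OF assms(1)] drazin_projection_pow(2)[OF assms(2)] by simp
  finally have ef: "?e = ?f" using 1 by simp
  have "x = x \<otimes> ?f" using xax c ef by (simp add: m_assoc)
  also have "\<dots> = ?e \<otimes> y" using c ax by (simp flip: m_assoc)
  also have "\<dots> = y" using ef ay yay by simp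
  finally show ?thesis .
qed

text \<open>The hypothesis on \<open>z\<close> can be fed into itself: \<open>a ^ k = a ^ j a ^ k z ^ j\<close> for all \<open>j\<close>. For
\<open>j = m\<close> the left factor \<open>a ^ m\<close> absorbs the idempotent \<open>ax\<close>, and therefore so does \<open>a ^ k\<close>.\<close>

lemma drazin_change_exponent:
  assumes d: "drazin m a x" and z: "z \<in> carrier G" and k: "a [^] k = a [^] Suc k \<otimes> z"
  shows "drazin k a x"
proof -
  have c: "a \<in> carrier G" "x \<in> carrier G" and ax: "a \<otimes> x = x \<otimes> a"
    using d by (auto simp: drazin_def)
  have *: "a [^] k = a [^] j \<otimes> a [^] k \<otimes> z [^] j" for j :: nat
  proof (induction j)
    case 0
    then show ?case using c z by simp
  next
    case (Suc j)
    have "a [^] k = a [^] j \<otimes> a [^] k \<otimes> z [^] j"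
      by (rule Suc)
    also have "\<dots> = a [^] j \<otimes> (a [^] Suc k \<otimes> z) \<otimes> z [^] j"
      by (simp only: k[symmetric])
    also have "a [^] Suc k = a \<otimes> a [^] k"
      using nat_pow_Suc2[OF c(1)] by simp
    also have "a [^] j \<otimes> (a \<otimes> a [^] k \<otimes> z) \<otimes> z [^] j = (a [^] j \<otimes> a) \<otimes> a [^] k \<otimes> (z \<otimes> z [^] j)"
      using c z by (simp only: m_assoc m_closed nat_pow_closed)
    also have "z \<otimes> z [^] j = z [^] Suc j"
      using nat_pow_Suc2[OF z] by simp
    finally show ?case by simp
  qed
  have "a [^] k \<otimes> x \<otimes> a = a [^] k \<otimes> (a \<otimes> x)"
    unfolding ax using c by (simp add: m_assoc)
  also have "\<dots> = (a \<otimes> x) \<otimes> a [^] k"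
    using commute_pow[of a "a \<otimes> x" k] commute_mult[OF c ax] c by simp
  also have "\<dots> = (a \<otimes> x) \<otimes> (a [^] m \<otimes> a [^] k \<otimes> z [^] m)"
    by (simp only: *[of m, symmetric])
  also have "\<dots> = ((a \<otimes> x) \<otimes> a [^] m) \<otimes> a [^] k \<otimes> z [^] m"
    using c z by (simp add: m_assoc)
  also have "\<dots> = a [^] k"
    by (simp only: drazin_pow_mult(1)[OF d] *[of m, symmetric])
  finally show ?thesis using d by (simp add: drazin_def)
qed

lemma drazin_conjugate:
  assumes d: "drazin m a x" and w: "w \<in> carrier G" "v \<in> carrier G" "v \<otimes> w = \<one>"
    and wv: "w \<otimes> v = \<one>"
  shows "drazin m (w \<otimes> a \<otimes> v) (w \<otimes> x \<otimes> v)"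
proof -
  have c: "a \<in> carrier G" "x \<in> carrier G" and ax: "a \<otimes> x = x \<otimes> a"
    and amx: "a [^] m \<otimes> x \<otimes> a = a [^] m" and xax: "x \<otimes> a \<otimes> x = x"
    using d by (auto simp: drazin_def)
  have mult: "(w \<otimes> s \<otimes> v) \<otimes> (w \<otimes> t \<otimes> v) = w \<otimes> (s \<otimes> t) \<otimes> v"
    if "s \<in> carrier G" "t \<in> carrier G" for s t
  proof -
    have "(w \<otimes> s \<otimes> v) \<otimes> (w \<otimes> t \<otimes> v) = w \<otimes> s \<otimes> (v \<otimes> w) \<otimes> (t \<otimes> v)"
      using that w(1,2) by (simp only: m_assoc m_closed)
    then show ?thesis using that w by (simp add: m_assoc)
  qed
  have pow: "(w \<otimes> a \<otimes> v) [^] m = w \<otimes> a [^] m \<otimes> v"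
    by (induction m) (use c w wv mult in auto)
  show ?thesis
    unfolding drazin_def pow using c w ax amx xax by (auto simp: mult)
qed

lemma drazin_add_exponent:
  assumes "drazin m a x"
  shows "drazin (m + j) a x"
proof -
  have c: "a \<in> carrier G" "x \<in> carrier G" using assms by (auto simp: drazin_def)
  have pow: "a [^] (m + j) = a [^] j \<otimes> a [^] m"
    using c nat_pow_mult[of a j m] by (simp add: add.commute)
  have "a [^] (m + j) \<otimes> x \<otimes> a = a [^] j \<otimes> (a [^] m \<otimes> x \<otimes> a)"
    unfolding pow using c by (simp add: m_assoc)
  also have "\<dots> = a [^] (m + j)"
    using assms by (simp add: drazin_def pow)
  finally show ?thesis using assms by (simp add: drazin_def)
qed

end

section \<open>Rank and factorization\<close>

context vec_space
begin

lemma col_space_mult_subset: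
  assumes "A \<in> carrier_mat n nc" "B \<in> carrier_mat nc k"
  shows "col_space (A * B) \<subseteq> col_space A"
proof -
  have AB: "A * B \<in> carrier_mat n k" using assms by simp
  show ?thesis
  proof
    fix y assume "y \<in> col_space (A * B)"
    then obtain x where "x \<in> carrier_vec k" "A * B *\<^sub>v x = y"
      using col_space_eq[OF AB] AB by auto
    then have "B *\<^sub>v x \<in> carrier_vec nc" "A *\<^sub>v (B *\<^sub>v x) = y" "y \<in> carrier_vec n"
      using assms AB by auto
    then show "y \<in> col_space A"
      using col_space_eq[OF assms(1)] assms(1) by auto
  qed
qed

lemma rank_mult_le:
  assumes A: "A \<in> carrier_mat n nc" and B: "B \<in> carrier_mat nc k"
  shows "rank (A * B) \<le> rank A"
proof -
  have AB: "A * B \<in> carrier_mat n k" using assms by simp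
  have sub: "subspace class_ring (span (set (cols C))) V" if "C \<in> carrier_mat n l" for C l
    using that cols_dim span_is_subspace by (metis carrier_matD(1))
  have "subspace class_ring (span (set (cols (A * B)))) (vs (span (set (cols A))))"
    using nested_subspaces[OF sub[OF A] sub[OF AB]] col_space_mult_subset[OF A B]
    by (simp add: col_space_def)
  from vectorspace.subspace_dim[OF subspace_is_vs[OF sub[OF A]] this fin_dim_span_cols[OF A]]
  show ?thesis using fin_dim_span_cols[OF AB] by (simp add: rank_def)
qed

text \<open>The column space of \<open>AB\<close> lies in that of \<open>A\<close>, and equal dimensions make the two equal. Each column
of \<open>A\<close> is then \<open>AB\<close> applied to some vector, and these vectors are the columns of \<open>Z\<close>.\<close>

lemma factor_of_rank_mult_eq:
  assumes A: "A \<in> carrier_mat n nc" and B: "B \<in> carrier_mat nc k"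
    and rank: "rank (A * B) = rank A"
  shows "\<exists>Z \<in> carrier_mat k nc. A = A * B * Z"
proof -
  have AB: "A * B \<in> carrier_mat n k" using assms by simp
  have cA: "set (cols A) \<subseteq> carrier_vec n" and cAB: "set (cols (A * B)) \<subseteq> carrier_vec n"
    using cols_dim[of A] cols_dim[of "A * B"] A AB by simp_all
  let ?W = "span (set (cols A))"
  have sub: "subspace class_ring ?W V"  and subm: "submodule class_ring ?W V"
    by (rule span_is_subspace[OF cA], rule span_is_submodule[OF cA])
  interpret W: vectorspace class_ring "vs ?W"
    using subspace_is_vs[OF sub] .
  \<comment> \<open>A maximal independent set of columns of \<open>AB\<close> has as many elements as the column space of \<open>A\<close>
    has dimensions, so it is a basis of the latter.\<close>
  let ?P = "\<lambda>T. T \<subseteq> set (cols (A * B)) \<and> lin_indpt T"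
  have "lin_indpt {}"
    unfolding lin_dep_def by blast
  then have "\<exists>U. finite U \<and> maximal U ?P \<and> {} \<subseteq> U"
    by (intro maximal_exists_superset[of "set (cols (A * B))"]) blast+
  then obtain U where U: "maximal U ?P" "finite U" by blast
  then have UAB: "U \<subseteq> set (cols (A * B))" and li: "lin_indpt U"
    unfolding maximal_def by blast+
  have UW: "U \<subseteq> ?W"
    using UAB in_own_span[OF cAB] col_space_mult_subset[OF A B] unfolding col_space_def by blast
  have "card U = W.dim"
    using rank_card_indpt[OF AB U(1)] rank unfolding rank_def by simp
  moreover have "W.lin_indpt U"
    using li span_li_not_depend(2)[OF UW subm] by simp
  ultimately have "W.basis U"
    using W.dim_li_is_basis[OF fin_dim_span_cols[OF A] U(2)] UW by simp
  then have "W.span U = ?W"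
    unfolding W.basis_def by simp
  then have "span U = ?W"
    using span_li_not_depend(1)[OF UW subm] by simp
  then have "?W \<subseteq> col_space (A * B)"
    using span_is_monotone[OF UAB] unfolding col_space_def by simp
  then have cols: "set (cols A) \<subseteq> col_space (A * B)"
    using in_own_span[OF cA] by blast
  have "\<exists>z \<in> carrier_vec k. (A * B) *\<^sub>v z = col A j" if "j < nc" for j
  proof -
    have "col A j \<in> set (cols A)" using that A by (metis carrier_matD(2) cols_length cols_nth nth_mem)
    then have "col A j \<in> col_space (A * B)" using cols by blast
    then show ?thesis unfolding col_space_eq[OF AB] using B by auto
  qed
  then obtain z where z: "\<And>j. j < nc \<Longrightarrow> z j \<in> carrier_vec k \<and> (A * B) *\<^sub>v z j = col A j"
    by metis
  let ?Z = "mat_of_cols k (map z [0..<nc])"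
  have Z: "?Z \<in> carrier_mat k nc" by (auto simp: mat_of_cols_def)
  have "A = A * B * ?Z"
  proof (rule mat_col_eqI)
    fix j assume "j < dim_col (A * B * ?Z)"
    then have j: "j < nc" using Z by simp
    then have "col (A * B * ?Z) j = (A * B) *\<^sub>v col ?Z j"
      using Z AB by (intro col_mult2[OF AB Z])
    also have "col ?Z j = z j"
      using z j by (subst col_mat_of_cols) auto
    finally show "col A j = col (A * B * ?Z) j" using z j by simp
  qed (use A Z AB in auto)
  then show ?thesis using Z by blast
qed

end

section \<open>Drazin inverses and the index of a matrix\<close>

definition mat_drazin :: "nat \<Rightarrow> nat \<Rightarrow> complex mat \<Rightarrow> complex mat \<Rightarrow> bool" where
  "mat_drazin N m M X \<longleftrightarrow> monoid.drazin (ring_mat TYPE(complex) N ()) m M X"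

lemma monoid_ring_mat: "monoid (ring_mat TYPE('a::semiring_1) N b)"
  using semiring_mat[where n = N and b = b and 'a = 'a] by (simp add: semiring_def)

lemma mat_drazin_iff:
  "mat_drazin N m M X \<longleftrightarrow> M \<in> carrier_mat N N \<and> X \<in> carrier_mat N N \<and>
     M ^\<^sub>m m * X * M = M ^\<^sub>m m \<and> X * M * X = X \<and> M * X = X * M"
proof (cases "M \<in> carrier_mat N N")
  case True
  show ?thesis
    unfolding mat_drazin_def monoid.drazin_def[OF monoid_ring_mat]
      pow_mat_ring_pow[OF True, of m "()", symmetric] ring_mat_simps ..
next
  case False
  then show ?thesis
    unfolding mat_drazin_def monoid.drazin_def[OF monoid_ring_mat] ring_mat_simps by blast
qed

lemma mat_drazin_unique:
  assumes "mat_drazin N m M X" "mat_drazin N m M Y"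
  shows "X = Y"
  by (rule monoid.drazin_unique[OF monoid_ring_mat assms[unfolded mat_drazin_def]])

lemma mat_drazin_add_exponent:
  assumes "mat_drazin N m M X"
  shows "mat_drazin N (m + j) M X"
  unfolding mat_drazin_def
  by (rule monoid.drazin_add_exponent[OF monoid_ring_mat assms[unfolded mat_drazin_def]])

lemma mat_drazin_similar:
  assumes "mat_drazin N m M X" "W \<in> carrier_mat N N" "V \<in> carrier_mat N N"
    "V * W = 1\<^sub>m N" "W * V = 1\<^sub>m N"
  shows "mat_drazin N m (W * M * V) (W * X * V)"
  using monoid.drazin_conjugate[OF monoid_ring_mat assms(1)[unfolded mat_drazin_def], of W V] assms(2-)
  unfolding mat_drazin_def ring_mat_simps by blast

text \<open>The equation at \<open>m\<close> reads \<open>M ^ m = M ^ (m + 1) * X\<close>, and multiplication does not raise the rank.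
So a matrix with a Drazin inverse at some exponent has an index at all: the \<open>LEAST\<close> that defines
it ranges over a nonempty set.\<close>

lemma mat_drazin_rank_eq:
  assumes "mat_drazin N m M X"
  shows "vec_space.rank N (M ^\<^sub>m m) = vec_space.rank N (M ^\<^sub>m (m + 1))"
proof -
  have c: "M \<in> carrier_mat N N" "X \<in> carrier_mat N N"
    using assms unfolding mat_drazin_iff by blast+
  have e: "M ^\<^sub>m m * X * M = M ^\<^sub>m m" and comm: "M * X = X * M"
    using assms unfolding mat_drazin_iff by blast+
  have "M ^\<^sub>m m = M ^\<^sub>m m * (X * M)"
    unfolding assoc_mult_mat[OF pow_carrier_mat[OF c(1)] c(2) c(1), symmetric] by (rule e[symmetric])
  also have "\<dots> = M ^\<^sub>m (m + 1) * X"
    unfolding comm[symmetric] assoc_mult_mat[OF pow_carrier_mat[OF c(1)] c(1) c(2), symmetric] by simp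
  finally have *: "M ^\<^sub>m m = M ^\<^sub>m (m + 1) * X" .
  have "vec_space.rank N (M ^\<^sub>m m) \<le> vec_space.rank N (M ^\<^sub>m (m + 1))"
    by (subst *) (rule vec_space.rank_mult_le, use c in auto)
  moreover have "vec_space.rank N (M ^\<^sub>m (m + 1)) \<le> vec_space.rank N (M ^\<^sub>m m)"
    using vec_space.rank_mult_le[of "M ^\<^sub>m m" N N M N] c by simp
  ultimately show ?thesis by simp
qed

text \<open>Conversely, rank stability at \<open>k\<close> alone suffices to bring the equations from an arbitrary exponent \<open>m\<close>
to \<open>k\<close>, whether \<open>k\<close> is smaller or larger than \<open>m\<close>.\<close>

lemma mat_drazin_rank_stable:
  assumes d: "mat_drazin N m M X"
    and rank: "vec_space.rank N (M ^\<^sub>m k) = vec_space.rank N (M ^\<^sub>m (k + 1))"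
  shows "mat_drazin N k M X"
proof -
  have c: "M \<in> carrier_mat N N" "X \<in> carrier_mat N N"
    using d unfolding mat_drazin_iff by blast+
  have "vec_space.rank N (M ^\<^sub>m k * M) = vec_space.rank N (M ^\<^sub>m k)"
    using rank by simp
  from vec_space.factor_of_rank_mult_eq[OF pow_carrier_mat[OF c(1)] c(1) this]
  obtain Z where Z: "Z \<in> carrier_mat N N" "M ^\<^sub>m k = M ^\<^sub>m k * M * Z"
    by blast
  let ?R = "ring_mat TYPE(complex) N ()"
  interpret R: monoid ?R by (rule monoid_ring_mat)
  have "M [^]\<^bsub>?R\<^esub> k = M [^]\<^bsub>?R\<^esub> Suc k \<otimes>\<^bsub>?R\<^esub> Z"
    unfolding pow_mat_ring_pow[OF c(1), symmetric] ring_mat_simps pow_mat.simps by (rule Z(2))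
  then show ?thesis
    using R.drazin_change_exponent[OF d[unfolded mat_drazin_def], of Z k] Z(1)
    unfolding mat_drazin_def ring_mat_simps by blast
qed

lemma mat_drazin_at_mat_index:
  assumes d: "mat_drazin N m M X"
  shows "mat_drazin N (mat_index M) M X"
proof -
  have M: "dim_row M = N" using d unfolding mat_drazin_iff by blast
  let ?P = "\<lambda>k. 0 < k \<and> vec_space.rank N (M ^\<^sub>m k) = vec_space.rank N (M ^\<^sub>m (k + 1))"
  \<comment> \<open>The successor is taken because the index is positive by definition, whereas \<open>m\<close> may be 0.\<close>
  have "?P (m + 1)"
    using mat_drazin_rank_eq[OF mat_drazin_add_exponent[OF d, of 1]] by simp
  then have "?P (mat_index M)"
    unfolding mat_index_def M by (rule LeastI)
  then show ?thesis
    using mat_drazin_rank_stable[OF d, of "mat_index M"] by blast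
qed

lemma mat_index_eq_1:
  assumes d: "mat_drazin N 1 M X"
  shows "mat_index M = 1"
proof -
  have M: "dim_row M = N" using d unfolding mat_drazin_iff by blast
  show ?thesis
    unfolding mat_index_def M
    using mat_drazin_rank_eq[OF d] by (intro Least_equality conjI) linarith+
qed

lemma is_mat_drazin_inverse_iff:
  assumes "M \<in> carrier_mat N N"
  shows "is_mat_drazin_inverse M X \<longleftrightarrow> mat_drazin N (mat_index M) M X"
  unfolding is_mat_drazin_inverse_def mat_drazin_iff carrier_matD(1)[OF assms]
  using assms by blast

section \<open>Core-nilpotent partitions\<close>

lemma mult_block_diag2:
  assumes "A \<in> carrier_mat r r" "B \<in> carrier_mat s s" "C \<in> carrier_mat r r" "D \<in> carrier_mat s s"
  shows "block_diag2 A B * block_diag2 C D = block_diag2 (A * C) (B * D)"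
  using assms unfolding block_diag2_def
  by (subst mult_four_block_mat[of _ r r _ s _ s _ _ r _ s]) auto

lemma pow_block_diag2:
  assumes "A \<in> carrier_mat r r" "B \<in> carrier_mat s s"
  shows "block_diag2 A B ^\<^sub>m k = block_diag2 (A ^\<^sub>m k) (B ^\<^sub>m k)"
  using pow_four_block_mat[OF assms, of k] assms by (simp add: block_diag2_def)

lemma mat_inverse_of_invertible_mat:
  fixes B :: "complex mat"
  assumes B: "B \<in> carrier_mat r r" and inv: "invertible_mat B"
  shows "\<exists>Bi \<in> carrier_mat r r. mat_inverse B = Some Bi \<and> B * Bi = 1\<^sub>m r \<and> Bi * B = 1\<^sub>m r"
proof -
  obtain E where E: "B * E = 1\<^sub>m (dim_row B)" "E * B = 1\<^sub>m (dim_row E)"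
    using inv by (auto simp: invertible_mat_def inverts_mat_def)
  have "dim_col (B * E) = dim_row B" "dim_col (E * B) = dim_row E"
    unfolding E by simp_all
  then have cE: "E \<in> carrier_mat r r" using B by auto
  have "B \<in> Units (ring_mat TYPE(complex) r ())"
    unfolding Units_def ring_mat_simps using B E cE by auto
  then obtain Bi where "mat_inverse B = Some Bi"
    using mat_inverse(1)[OF B, where b = "()"] by (cases "mat_inverse B") auto
  then show ?thesis using mat_inverse(2)[OF B] by blast
qed

text \<open>The exponent is the nilpotency exponent of \<open>C\<close>: there \<open>M ^ m = diag(B ^ m, 0)\<close>, on which \<open>diag(B\<^sup>-\<^sup>1, 0)\<close>
acts as an inverse of \<open>M\<close>.\<close>

lemma partition_drazin_mat_drazin:
  assumes M: "M \<in> carrier_mat n n" and part: "core_nilpotent_partition M B C"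
  shows "\<exists>m. mat_drazin n m M (partition_drazin B C)"
proof -
  have MBC: "M = block_diag2 B C" and inv: "invertible_mat B" and nil: "nilpotent_mat C"
    using part by (auto simp: core_nilpotent_partition_def)
  define r s where "r = dim_row B" and "s = dim_row C"
  have B: "B \<in> carrier_mat r r" and C: "C \<in> carrier_mat s s"
    using inv nil by (auto simp: r_def s_def invertible_mat_def nilpotent_mat_def)
  have "n = dim_row M" using M by simp
  then have n: "n = r + s" by (simp add: MBC block_diag2_def r_def s_def)
  obtain Bi where Bi: "Bi \<in> carrier_mat r r" "mat_inverse B = Some Bi" "B * Bi = 1\<^sub>m r" "Bi * B = 1\<^sub>m r"
    using mat_inverse_of_invertible_mat[OF B inv] by blast
  obtain m where m: "C ^\<^sub>m m = 0\<^sub>m s s"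
    using nil C by (auto simp: nilpotent_mat_def)
  have X: "partition_drazin B C = block_diag2 Bi (0\<^sub>m s s)"
    using Bi C by (simp add: partition_drazin_def)
  have carr: "block_diag2 E F \<in> carrier_mat n n"
    if "E \<in> carrier_mat r r" "F \<in> carrier_mat s s" for E F
    using that by (auto simp: block_diag2_def n)
  have BmBi: "B ^\<^sub>m m * Bi \<in> carrier_mat r r" "B * Bi \<in> carrier_mat r r" "Bi * B \<in> carrier_mat r r"
    using mult_carrier_mat[OF pow_carrier_mat[OF B] Bi(1)] B Bi(1) by simp_all
  have Bm: "B ^\<^sub>m m * Bi * B = B ^\<^sub>m m"
    unfolding assoc_mult_mat[OF pow_carrier_mat[OF B] Bi(1) B] Bi(4)
    by (rule right_mult_one_mat[OF pow_carrier_mat[OF B]])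
  note Z = zero_carrier_mat[of s s]
  have 1: "block_diag2 B C ^\<^sub>m m * block_diag2 Bi (0\<^sub>m s s) * block_diag2 B C = block_diag2 B C ^\<^sub>m m"
    unfolding pow_block_diag2[OF B C] m mult_block_diag2[OF pow_carrier_mat[OF B] Z Bi(1) Z]
    unfolding right_mult_zero_mat[OF Z] mult_block_diag2[OF BmBi(1) Z B C] left_mult_zero_mat[OF C] Bm ..
  have 2: "block_diag2 Bi (0\<^sub>m s s) * block_diag2 B C * block_diag2 Bi (0\<^sub>m s s) = block_diag2 Bi (0\<^sub>m s s)"
    unfolding mult_block_diag2[OF Bi(1) Z B C] Bi(4) left_mult_zero_mat[OF C]
      mult_block_diag2[OF one_carrier_mat Z Bi(1) Z] left_mult_one_mat[OF Bi(1)] left_mult_zero_mat[OF Z] ..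
  have 3: "block_diag2 B C * block_diag2 Bi (0\<^sub>m s s) = block_diag2 Bi (0\<^sub>m s s) * block_diag2 B C"
    unfolding mult_block_diag2[OF Bi(1) Z B C] mult_block_diag2[OF B C Bi(1) Z] Bi(3,4)
      left_mult_zero_mat[OF C] right_mult_zero_mat[OF C] ..
  have "mat_drazin n m (block_diag2 B C) (block_diag2 Bi (0\<^sub>m s s))"
    unfolding mat_drazin_iff using 1 2 3 carr[OF B C] carr[OF Bi(1) Z] by blast
  then show ?thesis using MBC X by auto
qed

section \<open>Block indices\<close>

text \<open>The index of the slice that \<open>bcirc\<close> places at block position \<open>(a, b)\<close> of a \<open>p \<times> p\<close> block matrix.\<close>

abbreviation cyc_diff :: "nat \<Rightarrow> nat \<Rightarrow> nat \<Rightarrow> nat" where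
  "cyc_diff p a b \<equiv> nat ((int a - int b) mod int p)"

lemma cyc_diff_eq:
  assumes "a < p" "b < p"
  shows "cyc_diff p a b = (if b \<le> a then a - b else a + p - b)"
proof (cases "b \<le> a")
  case True
  then have "(int a - int b) mod int p = int (a - b)"
    using assms by (simp add: of_nat_diff)
  then show ?thesis using True by simp
next
  case False
  have "(int a - int b) mod int p = (int a - int b + int p) mod int p" by simp
  also have "\<dots> = int (a + p - b)"
    using assms False by (subst mod_pos_pos_trivial) (auto simp: of_nat_diff)
  finally show ?thesis using False by simp
qed

text \<open>Every \<open>k < np\<close> is \<open>c * n + l\<close> for a block number \<open>c < p\<close> and an offset \<open>l < n\<close>. Splitting the summation
this way turns a matrix product into a product of block matrices.\<close>

lemma sum_block_index:
  fixes f :: "nat \<Rightarrow> 'a::comm_monoid_add"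
  shows "(\<Sum>k<n*p. f k) = (\<Sum>c<p. \<Sum>l<n. f (c*n+l))"
proof -
  have "(\<Sum>l<n. f (c*n+l)) = sum f {c*n..<c*n+n}" for c
    using sum.shift_bounds_nat_ivl[of f 0 "c*n" n] by (simp add: atLeast0LessThan add.commute)
  then show ?thesis
    using sum.nat_group[of f n p] by (simp add: mult.commute)
qed

lemma block_index_less:
  fixes a i n p :: nat
  assumes "a < p" "i < n"
  shows "a * n + i < n * p"
proof -
  have "a * n + i < Suc a * n" using assms by simp
  also have "\<dots> \<le> p * n" using assms by (intro mult_right_mono) auto
  finally show ?thesis by (simp add: mult.commute)
qed

lemma block_index_eq_iff:
  fixes i j n :: nat
  assumes "i < n" "j < n"
  shows "a*n+i = b*n+j \<longleftrightarrow> a = b \<and> i = j"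
proof
  assume eq: "a*n+i = b*n+j"
  have "(a*n+i) div n = (b*n+j) div n" "(a*n+i) mod n = (b*n+j) mod n" using eq by simp_all
  then show "a = b \<and> i = j" using assms by simp
qed simp

lemma eq_mat_blockI:
  assumes "M \<in> carrier_mat (n*p) (n*p)" "N \<in> carrier_mat (n*p) (n*p)"
    and "\<And>a b i j. a < p \<Longrightarrow> b < p \<Longrightarrow> i < n \<Longrightarrow> j < n \<Longrightarrow>
       M $$ (a*n+i, b*n+j) = N $$ (a*n+i, b*n+j)"
  shows "M = N"
proof (rule eq_matI)
  fix r c assume "r < dim_row N" "c < dim_col N"
  then have rc: "r < n*p" "c < n*p" using assms by auto
  then have "n > 0" by (cases n) auto
  then have *: "r div n < p" "c div n < p" "r mod n < n" "c mod n < n"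
    using rc by (auto simp: less_mult_imp_div_less mult.commute)
  show "M $$ (r, c) = N $$ (r, c)"
    using assms(3)[OF *] by simp
qed (use assms in auto)

lemma mult_mat_block_index:
  fixes M N :: "'a::comm_semiring_0 mat"
  assumes "M \<in> carrier_mat r (n*p)" "N \<in> carrier_mat (n*p) s" "i < r" "j < s"
  shows "(M * N) $$ (i, j) = (\<Sum>c<p. \<Sum>l<n. M $$ (i, c*n+l) * N $$ (c*n+l, j))"
proof -
  have "(M * N) $$ (i, j) = (\<Sum>k<n*p. M $$ (i, k) * N $$ (k, j))"
    using assms by (simp add: scalar_prod_def atLeast0LessThan)
  then show ?thesis by (simp add: sum_block_index)
qed

section \<open>The embedding of tensors as block circulant matrices\<close>

context
  fixes n p :: nat
  assumes n: "0 < n" and p: "0 < p"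
begin

lemma tensor_dims:
  assumes "A \<in> tensors n n p"
  shows "t_rows A = n" "t_cols A = n" "length A = p"
proof -
  show len: "length A = p" using assms by (simp add: tensors_def)
  then have "hd A \<in> set A" using p by (intro hd_in_set) auto
  then have "hd A \<in> carrier_mat n n" using assms by (auto simp: tensors_def)
  then show "t_rows A = n" "t_cols A = n" by (auto simp: t_rows_def t_cols_def)
qed

lemma tensor_slice:
  assumes "A \<in> tensors n n p" "k < p"
  shows "A ! k \<in> carrier_mat n n"
  using assms by (auto simp: tensors_def)

lemma bcirc_carrier:
  assumes "A \<in> tensors n n p"
  shows "bcirc A \<in> carrier_mat (n*p) (n*p)"
  using tensor_dims[OF assms] by (simp add: bcirc_def Let_def)

lemma bcirc_index:
  assumes "A \<in> tensors n n p" "a < p" "b < p" "i < n" "j < n"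
  shows "bcirc A $$ (a*n+i, b*n+j) = (A ! cyc_diff p a b) $$ (i, j)"
  using tensor_dims[OF assms(1)] assms n
  by (simp add: bcirc_def Let_def block_index_less)

lemma tensor_eqI:
  assumes "A \<in> tensors n n p" "B \<in> tensors n n p"
    and "\<And>k i j. k < p \<Longrightarrow> i < n \<Longrightarrow> j < n \<Longrightarrow> (A ! k) $$ (i, j) = (B ! k) $$ (i, j)"
  shows "A = B"
proof (rule nth_equalityI)
  show "length A = length B" using assms by (simp add: tensors_def)
  fix k assume "k < length A"
  then have k: "k < p" using assms by (simp add: tensors_def)
  show "A ! k = B ! k"
    using tensor_slice[OF assms(1) k] tensor_slice[OF assms(2) k] assms(3)[OF k]
    by (intro eq_matI) auto
qed

lemma bcirc_inject:
  assumes A: "A \<in> tensors n n p" and B: "B \<in> tensors n n p" and eq: "bcirc A = bcirc B"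
  shows "A = B"
proof (rule tensor_eqI[OF A B])
  fix k i j assume k: "k < p" and i: "i < n" and j: "j < n"
  show "(A ! k) $$ (i, j) = (B ! k) $$ (i, j)"
    using bcirc_index[OF A k p i j] bcirc_index[OF B k p i j] eq cyc_diff_eq[OF k p] by simp
qed

text \<open>The image of \<open>bcirc\<close> consists of all matrices whose blocks depend only on the cyclic difference of
the block indices; the function \<open>g\<close> lists the slices.\<close>

lemma block_circulant_is_bcirc:
  assumes "M \<in> carrier_mat (n*p) (n*p)"
    and "\<And>a b i j. a < p \<Longrightarrow> b < p \<Longrightarrow> i < n \<Longrightarrow> j < n \<Longrightarrow>
       M $$ (a*n+i, b*n+j) = g (cyc_diff p a b) i j"
  shows "\<exists>A \<in> tensors n n p. bcirc A = M"
proof -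
  let ?A = "map (\<lambda>k. mat n n (\<lambda>(i, j). g k i j)) [0..<p]"
  have A: "?A \<in> tensors n n p" by (auto simp: tensors_def)
  have "bcirc ?A = M"
    using assms cyc_diff_eq
    by (intro eq_mat_blockI[OF bcirc_carrier[OF A]]) (auto simp: bcirc_index[OF A])
  then show ?thesis using A by blast
qed

lemma t_mult_tensors:
  assumes "A \<in> tensors n n p" "B \<in> tensors n n p"
  shows "A \<star> B \<in> tensors n n p"
  using tensor_dims[OF assms(1)] tensor_dims[OF assms(2)] bcirc_carrier[OF assms(1)] p
  by (auto simp: t_mult_def fold_tensor_def Let_def tensors_def unfold_def)

lemma t_mult_index:
  assumes A: "A \<in> tensors n n p" and B: "B \<in> tensors n n p" and k: "k < p" and i: "i < n" and j: "j < n"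
  shows "((A \<star> B) ! k) $$ (i, j) = (\<Sum>c<p. \<Sum>l<n. (A ! cyc_diff p k c) $$ (i, l) * (B ! c) $$ (l, j))"
proof -
  note dA = tensor_dims[OF A] and dB = tensor_dims[OF B]
  have U: "unfold B \<in> carrier_mat (n*p) n"
    using dB by (simp add: unfold_def Let_def)
  have "((A \<star> B) ! k) $$ (i, j) = (bcirc A * unfold B) $$ (k*n+i, j)"
    using dA bcirc_carrier[OF A] U k i j p
    by (simp add: t_mult_def fold_tensor_def Let_def)
  also have "\<dots> = (\<Sum>c<p. \<Sum>l<n. bcirc A $$ (k*n+i, c*n+l) * unfold B $$ (c*n+l, j))"
    using block_index_less[OF k i] j by (intro mult_mat_block_index[OF bcirc_carrier[OF A] U])
  also have "\<dots> = (\<Sum>c<p. \<Sum>l<n. (A ! cyc_diff p k c) $$ (i, l) * (B ! c) $$ (l, j))"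
    using dB n k i j by (intro sum.cong refl) (simp add: bcirc_index[OF A] unfold_def Let_def block_index_less)
  finally show ?thesis .
qed

text \<open>The first block column of a product of block circulants is the T-product by definition. The other
columns agree because a cyclic shift of the summation index by \<open>b\<close> permutes the blocks.\<close>

lemma bcirc_mult:
  assumes A: "A \<in> tensors n n p" and B: "B \<in> tensors n n p"
  shows "bcirc (A \<star> B) = bcirc A * bcirc B"
proof (rule eq_mat_blockI[OF bcirc_carrier[OF t_mult_tensors[OF A B]]])
  fix a b i j assume a: "a < p" and b: "b < p" and i: "i < n" and j: "j < n"
  have lt: "cyc_diff p c b < p" for c
    using p by (simp add: nat_less_iff)
  have "bcirc (A \<star> B) $$ (a*n+i, b*n+j) =
      (\<Sum>c<p. \<Sum>l<n. (A ! cyc_diff p (cyc_diff p a b) c) $$ (i, l) * (B ! c) $$ (l, j))"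
    using lt[of a] by (simp add: bcirc_index[OF t_mult_tensors[OF A B] a b i j] t_mult_index[OF A B _ i j])
  also have "\<dots> = (\<Sum>c<p. \<Sum>l<n. (A ! cyc_diff p a c) $$ (i, l) * (B ! cyc_diff p c b) $$ (l, j))"
  proof (rule sum.reindex_bij_witness[of _ "\<lambda>c. cyc_diff p c b" "\<lambda>c. (c + b) mod p"])
    fix c assume "c \<in> {..<p}"
    then show "cyc_diff p ((c + b) mod p) b = c" "(c + b) mod p \<in> {..<p}"
      using p by (auto simp: zmod_int mod_simps)
    show "(\<Sum>l<n. (A ! cyc_diff p a ((c + b) mod p)) $$ (i, l) * (B ! cyc_diff p ((c + b) mod p) b) $$ (l, j))
      = (\<Sum>l<n. (A ! cyc_diff p (cyc_diff p a b) c) $$ (i, l) * (B ! c) $$ (l, j))"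
      using \<open>cyc_diff p ((c + b) mod p) b = c\<close> p by (simp add: zmod_int mod_simps algebra_simps)
  next
    fix c assume c: "c \<in> {..<p}"
    show "(cyc_diff p c b + b) mod p = c"
      using c b by (auto simp: cyc_diff_eq)
    show "cyc_diff p c b \<in> {..<p}" using lt by simp
  qed
  also have "\<dots> = (bcirc A * bcirc B) $$ (a*n+i, b*n+j)"
    using a b i j block_index_less[OF a i] block_index_less[OF b j]
    by (simp add: mult_mat_block_index[OF bcirc_carrier[OF A] bcirc_carrier[OF B]]
        bcirc_index[OF A] bcirc_index[OF B])
  finally show "bcirc (A \<star> B) $$ (a*n+i, b*n+j) = (bcirc A * bcirc B) $$ (a*n+i, b*n+j)" .
qed (use bcirc_carrier[OF A] bcirc_carrier[OF B] in auto)

lemma t_one_tensors: "t_one n p \<in> tensors n n p"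
  by (auto simp: t_one_def tensors_def)

lemma bcirc_one: "bcirc (t_one n p) = 1\<^sub>m (n*p)"
proof (rule eq_mat_blockI[OF bcirc_carrier[OF t_one_tensors]])
  fix a b i j assume a: "a < p" and b: "b < p" and i: "i < n" and j: "j < n"
  have d: "cyc_diff p a b < p" "cyc_diff p a b = 0 \<longleftrightarrow> a = b"
    using cyc_diff_eq[OF a b] a b by auto
  have "bcirc (t_one n p) $$ (a*n+i, b*n+j) = (t_one n p ! cyc_diff p a b) $$ (i, j)"
    by (rule bcirc_index[OF t_one_tensors a b i j])
  also have "t_one n p ! cyc_diff p a b = (if a = b then 1\<^sub>m n else 0\<^sub>m n n)"
    unfolding t_one_def using d p by (simp del: nat_0_iff nat_le_0)
  finally show "bcirc (t_one n p) $$ (a*n+i, b*n+j) = 1\<^sub>m (n*p) $$ (a*n+i, b*n+j)"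
    using i j block_index_less[OF a i] block_index_less[OF b j]
    by (simp add: block_index_eq_iff)
qed simp

lemma t_pow_tensors:
  assumes "A \<in> tensors n n p"
  shows "t_pow A k \<in> tensors n n p"
  by (induction k) (use assms tensor_dims[OF assms] t_one_tensors t_mult_tensors in auto)

lemma bcirc_pow:
  assumes "A \<in> tensors n n p"
  shows "bcirc (t_pow A k) = bcirc A ^\<^sub>m k"
proof (induction k)
  case 0
  then show ?case using tensor_dims[OF assms] bcirc_carrier[OF assms] bcirc_one by simp
next
  case (Suc k)
  then show ?case using bcirc_mult[OF t_pow_tensors[OF assms] assms] by simp
qed

end

section \<open>The Fourier matrix\<close>

lemma exp_root_of_unity_eq_cis:
  "exp (- (2 * of_real pi * \<i> / of_nat p)) = cis (- (2 * pi / real p))"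
  by (simp add: cis_conv_exp mult.commute)

lemma root_of_unity:
  assumes "0 < p"
  shows "exp (- (2 * of_real pi * \<i> / of_nat p)) ^ p = 1"
proof -
  have "exp (- (2 * of_real pi * \<i> / of_nat p)) ^ p = cis (- (2 * pi))"
    unfolding exp_root_of_unity_eq_cis DeMoivre using assms by simp
  also have "\<dots> = cnj (cis (2 * pi))"
    by (simp only: cis_cnj)
  finally show ?thesis by simp
qed

lemma cnj_root_of_unity:
  "cnj (exp (- (2 * of_real pi * \<i> / of_nat p))) * exp (- (2 * of_real pi * \<i> / of_nat p)) = 1"
  unfolding exp_root_of_unity_eq_cis by (simp add: cis_cnj cis_mult)

text \<open>\<open>\<omega> ^ k = 1\<close> makes \<open>2 \<pi> k / p\<close> a multiple of \<open>2 \<pi>\<close>, as its cosine is 1, and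
\<open>k < p\<close> leaves only the multiple 0.\<close>

lemma primitive_root_of_unity:
  assumes "k < p" "exp (- (2 * of_real pi * \<i> / of_nat p)) ^ k = 1"
  shows "k = 0"
proof -
  have p: "0 < p" using assms by simp
  have "cis (real k * - (2 * pi / real p)) = 1"
    using assms(2) unfolding exp_root_of_unity_eq_cis DeMoivre .
  then have "cos (real k * - (2 * pi / real p)) = 1"
    by (simp add: complex_eq_iff del: cos_minus mult_minus_right)
  then obtain m :: int where "real k * - (2 * pi / real p) = of_int m * 2 * pi"
    unfolding cos_one_2pi_int by blast
  then have "(- real k) * (2 * pi) = (of_int m * real p) * (2 * pi)"
    using p by (simp add: field_simps)
  then have "- real k = of_int m * real p"
    using mult_right_cancel[of "2 * pi"] pi_neq_zero by fastforce
  then have "real_of_int (- int k) = real_of_int (m * int p)"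
    by simp
  then have "- int k = m * int p"
    by (simp only: of_int_eq_iff)
  then have "int p dvd int k"
    by (metis dvd_minus_iff dvd_triv_right)
  then show ?thesis using assms(1) by (auto dest: nat_dvd_not_less)
qed

lemma dft_mat_carrier [simp]: "dft_mat p \<in> carrier_mat p p"
  by (simp add: dft_mat_def)

lemma mat_adjoint_index:
  assumes "A \<in> carrier_mat r c" "i < c" "j < r"
  shows "mat_adjoint A $$ (i, j) = conjugate (A $$ (j, i))"
  using assms by (simp add: mat_adjoint_def mat_of_rows_def)

lemma mat_adjoint_carrier [simp]:
  assumes "A \<in> carrier_mat r c"
  shows "mat_adjoint A \<in> carrier_mat c r"
  using assms by (auto simp: mat_adjoint_def)

text \<open>As \<open>\<omega> ^ p = 1\<close>, the exponent matters only modulo \<open>p\<close>. That the product is a function of \<open>a - b\<close>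
modulo \<open>p\<close> gives both the unitarity of \<open>F\<close>, through a geometric sum over \<open>c\<close>, and the circulant shape
of Fourier conjugates.\<close>

lemma dft_adjoint_mult_index:
  assumes p: "0 < p" and a: "a < p" and b: "b < p" and c: "c < p"
  shows "mat_adjoint (dft_mat p) $$ (a, c) * dft_mat p $$ (c, b) =
    cnj (exp (- (2 * of_real pi * \<i> / of_nat p))) ^ (c * cyc_diff p a b) / of_nat p"
proof -
  define w where "w = exp (- (2 * of_real pi * \<i> / of_nat p))"
  define v where "v = cnj w"
  have wp: "w ^ p = 1" and vw: "v * w = 1"
    using root_of_unity[OF p] cnj_root_of_unity[of p] by (simp_all only: w_def v_def)
  have vp: "v ^ p = 1" using arg_cong[OF wp, of cnj] by (simp add: v_def)
  have "v ^ (cyc_diff p a b) * v ^ b = v ^ a"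
    using a b vp by (simp add: cyc_diff_eq flip: power_add) (simp add: power_add)
  then have "v ^ a * w ^ b = v ^ cyc_diff p a b * (v * w) ^ b"
    by (simp add: power_mult_distrib)
  then have *: "v ^ a * w ^ b = v ^ cyc_diff p a b" using vw by simp
  have sq: "complex_of_real (sqrt (real p)) * of_real (sqrt (real p)) = of_nat p"
    by (metis of_real_mult of_real_of_nat_eq of_nat_0_le_iff real_sqrt_mult_self abs_of_nat)
  have "mat_adjoint (dft_mat p) $$ (a, c) * dft_mat p $$ (c, b)
     = (v ^ a) ^ c * (w ^ b) ^ c / of_nat p"
    using a b c unfolding mat_adjoint_index[OF dft_mat_carrier a c]
    by (simp add: dft_mat_def conjugate_complex_def sq flip: w_def power_mult)
      (simp add: v_def mult.commute)
  also have "\<dots> = v ^ (c * cyc_diff p a b) / of_nat p"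
    unfolding power_mult_distrib[symmetric] * by (simp add: mult.commute flip: power_mult)
  finally show ?thesis by (simp add: v_def w_def)
qed

lemma dft_mat_unitary:
  assumes p: "0 < p"
  shows "mat_adjoint (dft_mat p) * dft_mat p = 1\<^sub>m p" "dft_mat p * mat_adjoint (dft_mat p) = 1\<^sub>m p"
proof -
  define w where "w = exp (- (2 * of_real pi * \<i> / of_nat p))"
  have w: "w ^ p = 1"
    using root_of_unity[OF p] by (simp only: w_def)
  show 1: "mat_adjoint (dft_mat p) * dft_mat p = 1\<^sub>m p"
  proof (rule eq_matI)
    fix a b assume "a < dim_row (1\<^sub>m p :: complex mat)" "b < dim_col (1\<^sub>m p :: complex mat)"
    then have a: "a < p" and b: "b < p" by simp_all
    define d where "d = cyc_diff p a b"
    define z where "z = cnj w ^ d"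
    have d: "d < p" "d = 0 \<longleftrightarrow> a = b"
      using a b by (auto simp: d_def cyc_diff_eq)
    have "(mat_adjoint (dft_mat p) * dft_mat p) $$ (a, b)
        = (\<Sum>c<p. mat_adjoint (dft_mat p) $$ (a, c) * dft_mat p $$ (c, b))"
      using a b mult_mat_block_index[of "mat_adjoint (dft_mat p)" p 1 p "dft_mat p" p a b]
      by simp
    also have "\<dots> = (\<Sum>c<p. z ^ c) / of_nat p"
      unfolding sum_divide_distrib
      using dft_adjoint_mult_index[OF p a b]
      by (intro sum.cong refl) (simp add: z_def d_def w_def mult.commute flip: power_mult)
    also have "\<dots> = (if a = b then 1 else 0)"
    proof (cases "a = b")
      case True
      then show ?thesis using d p by (simp add: z_def)
    next
      case False
      then have "w ^ d \<noteq> 1"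
        using primitive_root_of_unity[OF d(1)] d(2) by (auto simp: w_def)
      then have "z \<noteq> 1"
        by (metis z_def complex_cnj_power complex_cnj_one complex_cnj_cnj)
      moreover have "z ^ p = cnj (w ^ p) ^ d"
        by (simp add: z_def mult.commute flip: power_mult)
      ultimately show ?thesis using False w by (simp add: geometric_sum)
    qed
    finally show "(mat_adjoint (dft_mat p) * dft_mat p) $$ (a, b) = 1\<^sub>m p $$ (a, b)"
      using a b by simp
  qed (simp_all add: carrier_matD[OF mat_adjoint_carrier[OF dft_mat_carrier]] carrier_matD[OF dft_mat_carrier])
  show "dft_mat p * mat_adjoint (dft_mat p) = 1\<^sub>m p"
    by (rule mat_mult_left_right_inverse[OF mat_adjoint_carrier[OF dft_mat_carrier] dft_mat_carrier 1])
qed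

lemma kronecker_one_carrier:
  assumes "A \<in> carrier_mat p p"
  shows "A \<otimes>\<^sub>K 1\<^sub>m n \<in> carrier_mat (n*p) (n*p)"
  using assms by (simp add: kronecker_def mult.commute)

lemma kronecker_one_index:
  assumes "A \<in> carrier_mat p p" "a < p" "b < p" "i < n" "j < n"
  shows "(A \<otimes>\<^sub>K 1\<^sub>m n) $$ (a*n+i, b*n+j) = (if i = j then A $$ (a, b) else 0)"
  using assms block_index_less[of a p i n] block_index_less[of b p j n]
  by (simp add: kronecker_def mult.commute)

lemma kronecker_one_mult:
  assumes A: "A \<in> carrier_mat p p" and B: "B \<in> carrier_mat p p"
  shows "(A \<otimes>\<^sub>K 1\<^sub>m n) * (B \<otimes>\<^sub>K 1\<^sub>m n) = (A * B) \<otimes>\<^sub>K 1\<^sub>m n"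
proof (rule eq_mat_blockI)
  fix a b i j assume a: "a < p" and b: "b < p" and i: "i < n" and j: "j < n"
  have AB: "A * B \<in> carrier_mat p p" using A B by simp
  have "((A \<otimes>\<^sub>K 1\<^sub>m n) * (B \<otimes>\<^sub>K 1\<^sub>m n)) $$ (a*n+i, b*n+j) =
     (\<Sum>c<p. \<Sum>l<n. (A \<otimes>\<^sub>K 1\<^sub>m n) $$ (a*n+i, c*n+l) * (B \<otimes>\<^sub>K 1\<^sub>m n) $$ (c*n+l, b*n+j))"
    by (intro mult_mat_block_index[OF kronecker_one_carrier[OF A] kronecker_one_carrier[OF B]]
        block_index_less a b i j)
  also have "\<dots> = (\<Sum>c<p. \<Sum>l<n. if l = i then (if i = j then A $$ (a, c) * B $$ (c, b) else 0) else 0)"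
    using a b i j by (intro sum.cong refl) (auto simp: kronecker_one_index[OF A] kronecker_one_index[OF B])
  also have "\<dots> = (if i = j then (A * B) $$ (a, b) else 0)"
    using a b i A B by (simp add: scalar_prod_def atLeast0LessThan)
  finally show "((A \<otimes>\<^sub>K 1\<^sub>m n) * (B \<otimes>\<^sub>K 1\<^sub>m n)) $$ (a*n+i, b*n+j) = ((A * B) \<otimes>\<^sub>K 1\<^sub>m n) $$ (a*n+i, b*n+j)"
    by (simp add: kronecker_one_index[OF AB a b i j])
qed (use A B in \<open>auto intro!: mult_carrier_mat kronecker_one_carrier\<close>)

lemma kronecker_one_one: "(1\<^sub>m p \<otimes>\<^sub>K 1\<^sub>m n) = 1\<^sub>m (n*p)"
proof (rule eq_mat_blockI)
  fix a b i j assume a: "a < p" and b: "b < p" and i: "i < n" and j: "j < n"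
  show "(1\<^sub>m p \<otimes>\<^sub>K 1\<^sub>m n) $$ (a*n+i, b*n+j) = 1\<^sub>m (n*p) $$ (a*n+i, b*n+j)"
    using block_index_less[OF a i] block_index_less[OF b j] a b i j
    by (auto simp: kronecker_one_index[OF one_carrier_mat a b i j] block_index_eq_iff[OF i j])
qed (auto intro: kronecker_one_carrier)

section \<open>Block diagonal matrices with blocks of equal size\<close>

lemma diag_block_mat_carrier:
  assumes "\<And>c. c < q \<Longrightarrow> D c \<in> carrier_mat n n"
  shows "diag_block_mat (map D [0..<q]) \<in> carrier_mat (n*q) (n*q)"
proof -
  have "dim_row (D c) = n" "dim_col (D c) = n" if "c < q" for c
    using assms[OF that] by auto
  then have "map (dim_row \<circ> D) [0..<q] = map (\<lambda>_. n) [0..<q]"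
      "map (dim_col \<circ> D) [0..<q] = map (\<lambda>_. n) [0..<q]"
    by auto
  then show ?thesis
    by (intro carrier_matI) (simp_all only: dim_diag_block_mat map_map, simp_all add: sum_list_triv mult.commute)
qed

lemma diag_block_mat_index:
  assumes "\<And>c. c < q \<Longrightarrow> D c \<in> carrier_mat n n" "a < q" "b < q" "i < n" "j < n"
  shows "diag_block_mat (map D [0..<q]) $$ (a*n+i, b*n+j) = (if a = b then D a $$ (i, j) else 0)"
  using assms
proof (induction q)
  case 0
  then show ?case by simp
next
  case (Suc q)
  have E: "diag_block_mat (map D [0..<q]) \<in> carrier_mat (n*q) (n*q)"
    using Suc.prems(1) by (intro diag_block_mat_carrier) simp
  have Dq: "D q \<in> carrier_mat n n" using Suc.prems(1) by simp
  have IH: "a < q \<Longrightarrow> b < q \<Longrightarrow> diag_block_mat (map D [0..<q]) $$ (a*n+i, b*n+j) = (if a = b then D a $$ (i, j) else 0)"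
    using Suc.IH Suc.prems by simp
  have a: "a < q \<or> a = q" and b: "b < q \<or> b = q" using Suc.prems by auto
  have la: "a < q \<Longrightarrow> a * n + i < n * q" and lb: "b < q \<Longrightarrow> b * n + j < n * q"
    using block_index_less Suc.prems by auto
  have "diag_block_mat (map D [0..<Suc q]) $$ (a*n+i, b*n+j) =
    four_block_mat (diag_block_mat (map D [0..<q])) (0\<^sub>m (n*q) n) (0\<^sub>m n (n*q)) (D q) $$ (a*n+i, b*n+j)"
    using E Dq by (simp add: diag_block_mat_last Let_def)
  also have "\<dots> = (if a = b then D a $$ (i, j) else 0)"
    unfolding four_block_mat_def Let_def
    using a b la lb carrier_matD[OF E] carrier_matD[OF Dq] Suc.prems(4,5) IH
    by (elim disjE) (auto simp: mult.commute)
  finally show ?case .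
qed

lemma diag_block_mat_mult:
  fixes D E :: "nat \<Rightarrow> complex mat"
  assumes D: "\<And>c. c < p \<Longrightarrow> D c \<in> carrier_mat n n" and E: "\<And>c. c < p \<Longrightarrow> E c \<in> carrier_mat n n"
  shows "diag_block_mat (map D [0..<p]) * diag_block_mat (map E [0..<p]) =
    diag_block_mat (map (\<lambda>c. D c * E c) [0..<p])"
proof (rule eq_mat_blockI)
  have DE: "\<And>c. c < p \<Longrightarrow> D c * E c \<in> carrier_mat n n"
    using mult_carrier_mat[OF D E] by blast
  have cD: "diag_block_mat (map D [0..<p]) \<in> carrier_mat (n*p) (n*p)"
    and cE: "diag_block_mat (map E [0..<p]) \<in> carrier_mat (n*p) (n*p)"
    using D E by (auto intro!: diag_block_mat_carrier)
  show "diag_block_mat (map D [0..<p]) * diag_block_mat (map E [0..<p]) \<in> carrier_mat (n*p) (n*p)"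
    using cD cE by (rule mult_carrier_mat)
  show "diag_block_mat (map (\<lambda>c. D c * E c) [0..<p]) \<in> carrier_mat (n*p) (n*p)"
    using DE by (rule diag_block_mat_carrier)
  fix a b i j assume a: "a < p" and b: "b < p" and i: "i < n" and j: "j < n"
  have iD: "diag_block_mat (map D [0..<p]) $$ (a*n+i, c*n+l) = (if a = c then D a $$ (i, l) else 0)"
    and iE: "diag_block_mat (map E [0..<p]) $$ (c*n+l, b*n+j) = (if c = b then E c $$ (l, j) else 0)"
    if "c < p" "l < n" for c l
    by (rule diag_block_mat_index[OF D a that(1) i that(2)], assumption,
        rule diag_block_mat_index[OF E that(1) b that(2) j], assumption)
  have "(diag_block_mat (map D [0..<p]) * diag_block_mat (map E [0..<p])) $$ (a*n+i, b*n+j)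
     = (\<Sum>c<p. \<Sum>l<n. diag_block_mat (map D [0..<p]) $$ (a*n+i, c*n+l) *
          diag_block_mat (map E [0..<p]) $$ (c*n+l, b*n+j))"
    using block_index_less[OF a i] block_index_less[OF b j]
    by (rule mult_mat_block_index[OF cD cE])
  also have "\<dots> = (\<Sum>c<p. if c = a then (if a = b then \<Sum>l<n. D a $$ (i, l) * E a $$ (l, j) else 0) else 0)"
    using a b i j iD iE by (intro sum.cong refl) auto
  also have "\<dots> = (if a = b then \<Sum>l<n. D a $$ (i, l) * E a $$ (l, j) else 0)"
    using a by simp
  also have "\<dots> = (if a = b then (D a * E a) $$ (i, j) else 0)"
    using i j carrier_matD[OF D[OF a]] carrier_matD[OF E[OF a]]
    by (intro if_cong refl) (simp add: scalar_prod_def atLeast0LessThan)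
  also have "\<dots> = diag_block_mat (map (\<lambda>c. D c * E c) [0..<p]) $$ (a*n+i, b*n+j)"
    using DE a b i j by (intro diag_block_mat_index[symmetric])
  finally show "(diag_block_mat (map D [0..<p]) * diag_block_mat (map E [0..<p])) $$ (a*n+i, b*n+j) =
    diag_block_mat (map (\<lambda>c. D c * E c) [0..<p]) $$ (a*n+i, b*n+j)" .
qed

text \<open>Products and powers of block diagonal matrices are formed block by block, so the equations in the blocks
add up to those of the whole, provided that all blocks use the same exponent.\<close>

lemma mat_drazin_diag_block_mat:
  assumes "\<And>c. c < p \<Longrightarrow> mat_drazin n m (D c) (E c)"
  shows "mat_drazin (n*p) m (diag_block_mat (map D [0..<p])) (diag_block_mat (map E [0..<p]))"
proof -
  have D: "D c \<in> carrier_mat n n" and E: "E c \<in> carrier_mat n n"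
    and eqs: "D c ^\<^sub>m m * E c * D c = D c ^\<^sub>m m" "E c * D c * E c = E c" "D c * E c = E c * D c"
    if "c < p" for c
    using assms[OF that] unfolding mat_drazin_iff by blast+
  let ?d = "\<lambda>F. diag_block_mat (map F [0..<p])"
  have cong: "?d F = ?d G" if "\<And>c. c < p \<Longrightarrow> F c = G c" for F G :: "nat \<Rightarrow> complex mat"
    using that by (intro arg_cong[where f = diag_block_mat] map_cong) auto
  have Dm: "D c ^\<^sub>m m \<in> carrier_mat n n" if "c < p" for c
    using D[OF that] by (rule pow_carrier_mat)
  have "Ball (set (map D [0..<p])) square_mat"
    using carrier_matD[OF D] by simp
  from diag_block_pow_mat[OF this, of m] have pow: "?d D ^\<^sub>m m = ?d (\<lambda>c. D c ^\<^sub>m m)"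
    by (simp add: comp_def)
  have 1: "?d D ^\<^sub>m m * ?d E * ?d D = ?d D ^\<^sub>m m"
  proof -
    have "?d D ^\<^sub>m m * ?d E * ?d D = ?d (\<lambda>c. D c ^\<^sub>m m * E c) * ?d D"
      unfolding pow by (subst diag_block_mat_mult[OF Dm E]) auto
    also have "\<dots> = ?d (\<lambda>c. D c ^\<^sub>m m * E c * D c)"
      by (rule diag_block_mat_mult[OF mult_carrier_mat[OF Dm E] D])
    also have "\<dots> = ?d D ^\<^sub>m m"
      unfolding pow by (rule cong) (rule eqs(1))
    finally show ?thesis .
  qed
  have 2: "?d E * ?d D * ?d E = ?d E"
  proof -
    have "?d E * ?d D * ?d E = ?d (\<lambda>c. E c * D c) * ?d E"
      by (subst diag_block_mat_mult[OF E D]) auto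
    also have "\<dots> = ?d (\<lambda>c. E c * D c * E c)"
      by (rule diag_block_mat_mult[OF mult_carrier_mat[OF E D] E])
    also have "\<dots> = ?d E"
      by (rule cong) (rule eqs(2))
    finally show ?thesis .
  qed
  have 3: "?d D * ?d E = ?d E * ?d D"
  proof -
    have "?d D * ?d E = ?d (\<lambda>c. D c * E c)"
      by (rule diag_block_mat_mult[OF D E])
    also have "\<dots> = ?d (\<lambda>c. E c * D c)"
      by (rule cong) (rule eqs(3))
    also have "\<dots> = ?d E * ?d D"
      by (rule diag_block_mat_mult[OF E D, symmetric])
    finally show ?thesis .
  qed
  have "?d D \<in> carrier_mat (n*p) (n*p)" "?d E \<in> carrier_mat (n*p) (n*p)"
    using D E by (auto intro!: diag_block_mat_carrier)
  then show ?thesis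
    unfolding mat_drazin_iff using 1 2 3 by blast
qed

section \<open>Fourier block diagonalization\<close>

context
  fixes n p :: nat
  assumes n: "0 < n" and p: "0 < p"
begin

abbreviation "dft_hat \<equiv> dft_mat p \<otimes>\<^sub>K 1\<^sub>m n"
abbreviation "dft_hat_adj \<equiv> mat_adjoint (dft_mat p) \<otimes>\<^sub>K 1\<^sub>m n"

lemma dft_hat_carrier:
  "dft_hat \<in> carrier_mat (n*p) (n*p)" "dft_hat_adj \<in> carrier_mat (n*p) (n*p)"
  by (rule kronecker_one_carrier[OF dft_mat_carrier],
      rule kronecker_one_carrier[OF mat_adjoint_carrier[OF dft_mat_carrier]])

lemma dft_hat_unitary:
  "dft_hat * dft_hat_adj = 1\<^sub>m (n*p)" "dft_hat_adj * dft_hat = 1\<^sub>m (n*p)"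
  unfolding kronecker_one_mult[OF dft_mat_carrier mat_adjoint_carrier[OF dft_mat_carrier]]
    kronecker_one_mult[OF mat_adjoint_carrier[OF dft_mat_carrier] dft_mat_carrier]
    dft_mat_unitary[OF p] kronecker_one_one by (rule refl)+

lemma mat_drazin_fourier_block_diag:
  assumes "\<And>c. c < p \<Longrightarrow> mat_drazin n m (D c) (E c)"
  shows "mat_drazin (n*p) m (fourier_block_diag n p D) (fourier_block_diag n p E)"
  unfolding fourier_block_diag_def
  using mat_drazin_diag_block_mat[where D = D and E = E, OF assms] dft_hat_carrier(2,1) dft_hat_unitary
  by (rule mat_drazin_similar)

lemma fourier_block_diag_is_bcirc:
  assumes D: "\<And>c. c < p \<Longrightarrow> D c \<in> carrier_mat n n"
  shows "\<exists>A \<in> tensors n n p. bcirc A = fourier_block_diag n p D"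
proof (rule block_circulant_is_bcirc[OF n p])
  let ?E = "diag_block_mat (map D [0..<p])"
  have c: "?E \<in> carrier_mat (n*p) (n*p)"
    using D by (rule diag_block_mat_carrier)
  let ?F = "dft_mat p" and ?Fa = "mat_adjoint (dft_mat p)"
  note cFa = mat_adjoint_carrier[OF dft_mat_carrier[of p]]
  have cFE: "dft_hat_adj * ?E \<in> carrier_mat (n*p) (n*p)"
    using dft_hat_carrier(2) c by (rule mult_carrier_mat)
  have iE: "?E $$ (d*n+k, c*n+l) = (if d = c then D d $$ (k, l) else 0)"
    if "d < p" "c < p" "k < n" "l < n" for d c k l
    using D that by (rule diag_block_mat_index)
  show "fourier_block_diag n p D \<in> carrier_mat (n*p) (n*p)"
    unfolding fourier_block_diag_def using cFE dft_hat_carrier(1) by (rule mult_carrier_mat)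
  fix a b i j assume a: "a < p" and b: "b < p" and i: "i < n" and j: "j < n"
  \<comment> \<open>Multiplying by the block diagonal matrix collapses both inner sums to the summand of block
    \<open>c\<close> and offset \<open>i\<close>.\<close>
  have 1: "(dft_hat_adj * ?E) $$ (a*n+i, c*n+l) = ?Fa $$ (a, c) * D c $$ (i, l)"
    if cl: "c < p" "l < n" for c l
  proof -
    have "(dft_hat_adj * ?E) $$ (a*n+i, c*n+l) =
       (\<Sum>d<p. \<Sum>k<n. dft_hat_adj $$ (a*n+i, d*n+k) * ?E $$ (d*n+k, c*n+l))"
      using block_index_less[OF a i] block_index_less[OF cl]
      by (rule mult_mat_block_index[OF dft_hat_carrier(2) c])
    also have "\<dots> = (\<Sum>d<p. if d = c then \<Sum>k<n. if k = i then ?Fa $$ (a, c) * D c $$ (i, l) else 0 else 0)"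
    proof (intro sum.cong refl)
      fix d assume "d \<in> {..<p}"
      then have d: "d < p" by simp
      have "dft_hat_adj $$ (a*n+i, d*n+k) * ?E $$ (d*n+k, c*n+l) =
          (if d = c then if k = i then ?Fa $$ (a, c) * D c $$ (i, l) else 0 else 0)"
        if k: "k < n" for k
        unfolding kronecker_one_index[OF cFa a d i k] iE[OF d cl(1) k cl(2)] by simp
      then have "(\<Sum>k<n. dft_hat_adj $$ (a*n+i, d*n+k) * ?E $$ (d*n+k, c*n+l)) =
          (\<Sum>k<n. if d = c then if k = i then ?Fa $$ (a, c) * D c $$ (i, l) else 0 else 0)"
        by (intro sum.cong refl) simp
      then show "(\<Sum>k<n. dft_hat_adj $$ (a*n+i, d*n+k) * ?E $$ (d*n+k, c*n+l)) =
          (if d = c then \<Sum>k<n. if k = i then ?Fa $$ (a, c) * D c $$ (i, l) else 0 else 0)"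
        by (cases "d = c") simp_all
    qed
    also have "\<dots> = ?Fa $$ (a, c) * D c $$ (i, l)"
      using cl i by simp
    finally show ?thesis .
  qed
  have "fourier_block_diag n p D $$ (a*n+i, b*n+j) =
     (\<Sum>c<p. \<Sum>l<n. (dft_hat_adj * ?E) $$ (a*n+i, c*n+l) * dft_hat $$ (c*n+l, b*n+j))"
    unfolding fourier_block_diag_def
    using block_index_less[OF a i] block_index_less[OF b j]
    by (rule mult_mat_block_index[OF cFE dft_hat_carrier(1)])
  also have "\<dots> = (\<Sum>c<p. \<Sum>l<n. if l = j then ?Fa $$ (a, c) * ?F $$ (c, b) * D c $$ (i, j) else 0)"
    by (intro sum.cong refl) (simp add: 1 kronecker_one_index[OF dft_mat_carrier _ b _ j])
  also have "\<dots> = (\<Sum>c<p. ?Fa $$ (a, c) * ?F $$ (c, b) * D c $$ (i, j))"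
    using j by simp
  also have "\<dots> = (\<Sum>c<p. cnj (exp (- (2 * of_real pi * \<i> / of_nat p))) ^ (c * cyc_diff p a b)
      / of_nat p * D c $$ (i, j))"
    using dft_adjoint_mult_index[OF p a b] by (intro sum.cong refl) auto
  finally show "fourier_block_diag n p D $$ (a*n+i, b*n+j) =
    (\<lambda>d i j. \<Sum>c<p. cnj (exp (- (2 * of_real pi * \<i> / of_nat p))) ^ (c * d) / of_nat p * D c $$ (i, j))
      (cyc_diff p a b) i j" .
qed

section \<open>T-Drazin and T-group inverses\<close>

lemma t_drazin_equations_iff:
  assumes A: "A \<in> tensors n n p" and X: "X \<in> tensors n n p"
  shows "t_pow A k \<star> X \<star> A = t_pow A k \<and> X \<star> A \<star> X = X \<and> A \<star> X = X \<star> A \<longleftrightarrow>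
    mat_drazin (n*p) k (bcirc A) (bcirc X)"
proof -
  note mult = t_mult_tensors[OF n p] and bm = bcirc_mult[OF n p]
  have inj: "bcirc B = bcirc C \<longleftrightarrow> B = C" if "B \<in> tensors n n p" "C \<in> tensors n n p" for B C
    using bcirc_inject[OF n p that] by blast
  note Ak = t_pow_tensors[OF n p A, of k]
  note eqs = inj[OF mult[OF mult[OF Ak X] A] Ak] inj[OF mult[OF mult[OF X A] X] X]
    inj[OF mult[OF A X] mult[OF X A]]
  show ?thesis
    unfolding mat_drazin_iff eqs[symmetric] bm[OF mult[OF Ak X] A] bm[OF Ak X] bm[OF mult[OF X A] X]
      bm[OF X A] bm[OF A X] bcirc_pow[OF n p A]
    by (simp only: bcirc_carrier[OF n p A] bcirc_carrier[OF n p X] simp_thms)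
qed

lemma is_t_drazin_inverse_iff:
  assumes A: "A \<in> tensors n n p"
  shows "is_t_drazin_inverse A X \<longleftrightarrow>
    X \<in> tensors n n p \<and> mat_drazin (n*p) (t_index A) (bcirc A) (bcirc X)"
  unfolding is_t_drazin_inverse_def tensor_dims[OF n p A]
  by (rule conj_cong[OF refl]) (rule t_drazin_equations_iff[OF A])

lemma is_t_group_inverse_iff:
  assumes A: "A \<in> tensors n n p"
  shows "is_t_group_inverse A X \<longleftrightarrow> X \<in> tensors n n p \<and> mat_drazin (n*p) 1 (bcirc A) (bcirc X)"
proof -
  have "bcirc (t_pow A 1) = bcirc A"
    unfolding bcirc_pow[OF n p A] using bcirc_carrier[OF n p A] by simp
  then have pow: "t_pow A 1 = A"
    by (rule bcirc_inject[OF n p t_pow_tensors[OF n p A] A])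
  show ?thesis
    unfolding is_t_group_inverse_def tensor_dims[OF n p A]
    by (rule conj_cong[OF refl]) (rule t_drazin_equations_iff[OF A, of _ 1, unfolded pow])
qed

text \<open>The group inverse equations are the Drazin equations at exponent 1. They are unsolvable unless the
index is 1 (\<open>mat_index_eq_1\<close>), and at index 1 the two systems of equations are the same.\<close>

lemma t_group_inverse_iff_index_1:
  assumes A: "A \<in> tensors n n p"
  shows "is_t_group_inverse A X \<longleftrightarrow> t_index A = 1 \<and> is_t_drazin_inverse A X"
proof (cases "t_index A = 1")
  case True
  then show ?thesis
    unfolding is_t_group_inverse_iff[OF A] is_t_drazin_inverse_iff[OF A] by simp
next
  case False
  then show ?thesis
    unfolding is_t_group_inverse_iff[OF A] t_index_def
    using mat_index_eq_1[of "n*p" "bcirc A" "bcirc X"] by blast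
qed

text \<open>The T-inverse is a definite description; it denotes an inverse since two-sided inverses of the matrix
\<open>bcirc P\<close> are unique and \<open>bcirc\<close> is injective.\<close>

lemma t_inverse_bcirc:
  assumes P: "P \<in> tensors n n p" and inv: "t_invertible P"
  shows "t_inverse P \<in> tensors n n p"
    "bcirc P * bcirc (t_inverse P) = 1\<^sub>m (n*p)" "bcirc (t_inverse P) * bcirc P = 1\<^sub>m (n*p)"
proof -
  have iff: "is_t_inverse P X \<longleftrightarrow> X \<in> tensors n n p \<and>
      P \<star> X = t_one n p \<and> X \<star> P = t_one n p" for X
    unfolding is_t_inverse_def Let_def tensor_dims[OF n p P] using P by blast
  have bc: "X \<in> tensors n n p \<and> bcirc P * bcirc X = 1\<^sub>m (n*p) \<and> bcirc X * bcirc P = 1\<^sub>m (n*p)"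
    if "is_t_inverse P X" for X
  proof -
    have X: "X \<in> tensors n n p" and inv: "P \<star> X = t_one n p" "X \<star> P = t_one n p"
      using that unfolding iff by blast+
    then show ?thesis
      unfolding bcirc_mult[OF n p P X, symmetric] bcirc_mult[OF n p X P, symmetric] inv bcirc_one[OF n p]
      by blast
  qed
  have unique: "X = Y" if "is_t_inverse P X" "is_t_inverse P Y" for X Y
  proof -
    note X = bc[OF that(1)] and Y = bc[OF that(2)]
    note cX = bcirc_carrier[OF n p conjunct1[OF X]] and cY = bcirc_carrier[OF n p conjunct1[OF Y]]
      and cP = bcirc_carrier[OF n p P]
    have "bcirc X = bcirc X * (bcirc P * bcirc Y)"
      unfolding conjunct1[OF conjunct2[OF Y]] by (rule right_mult_one_mat[OF cX, symmetric])
    also have "\<dots> = bcirc X * bcirc P * bcirc Y"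
      by (rule assoc_mult_mat[OF cX cP cY, symmetric])
    also have "\<dots> = bcirc Y"
      unfolding conjunct2[OF conjunct2[OF X]] by (rule left_mult_one_mat[OF cY])
    finally show ?thesis
      by (rule bcirc_inject[OF n p conjunct1[OF X] conjunct1[OF Y]])
  qed
  obtain Y where Y: "is_t_inverse P Y" using inv unfolding t_invertible_def ..
  have "is_t_inverse P (t_inverse P)"
    unfolding t_inverse_def by (rule theI[of "is_t_inverse P", OF Y]) (rule unique[OF _ Y])
  from bc[OF this] show "t_inverse P \<in> tensors n n p"
    "bcirc P * bcirc (t_inverse P) = 1\<^sub>m (n*p)" "bcirc (t_inverse P) * bcirc P = 1\<^sub>m (n*p)"
    by blast+
qed

end

section \<open>The T-Drazin inverse from the T-Jordan form\<close>

theorem theorem15: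
  fixes n p k :: nat
    and A P J :: ctensor
    and Js J1 J0 :: "nat \<Rightarrow> complex mat"
  assumes "0 < n" and "0 < p"
    and "A \<in> tensors n n p"
    and "t_jordan_form n p A P J Js"
    and "\<forall>i<p. core_nilpotent_partition (Js i) (J1 i) (J0 i)"
    and "k = t_index A"
  shows
    "(\<forall>i<p. is_mat_drazin_inverse (Js i) (partition_drazin (J1 i) (J0 i))) \<and>
     (\<exists>!JD. JD \<in> tensors n n p \<and>
        bcirc JD = fourier_block_diag n p (\<lambda>i. partition_drazin (J1 i) (J0 i))) \<and>
     (\<forall>JD \<in> tensors n n p.
        bcirc JD = fourier_block_diag n p (\<lambda>i. partition_drazin (J1 i) (J0 i)) \<longrightarrow>
        is_t_drazin_inverse A (t_inverse P \<star> JD \<star> P) \<and>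
        t_drazin_inverse A = t_inverse P \<star> JD \<star> P) \<and>
     (\<forall>X \<in> tensors n n p.
        t_pow A k \<star> X \<star> A = t_pow A k \<and> X \<star> A \<star> X = X \<and> A \<star> X = X \<star> A \<longleftrightarrow>
        X = t_drazin_inverse A) \<and>
     (\<forall>X. is_t_group_inverse A X \<longleftrightarrow> t_index A = 1 \<and> is_t_drazin_inverse A X)"
proof -
  note n = assms(1) and p = assms(2) and A = assms(3)
  define JDs where "JDs = (\<lambda>i. partition_drazin (J1 i) (J0 i))"
  have P: "P \<in> tensors n n p" and J: "J \<in> tensors n n p" and inv: "t_invertible P"
    and APJ: "A = t_inverse P \<star> J \<star> P" and bJ: "bcirc J = fourier_block_diag n p Js"
    and Js: "\<And>i. i < p \<Longrightarrow> Js i \<in> carrier_mat n n"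
    using assms(4) unfolding t_jordan_form_def ordered_jordan_def by blast+
  note Pi = t_inverse_bcirc[OF n p P inv]
  note mult = t_mult_tensors[OF n p] and bm = bcirc_mult[OF n p]

  have ex: "\<exists>m. mat_drazin n m (Js i) (JDs i)" if "i < p" for i
    using partition_drazin_mat_drazin[OF Js[OF that]] assms(5) that unfolding JDs_def by blast
  then obtain m where m: "\<And>i. i < p \<Longrightarrow> mat_drazin n (m i) (Js i) (JDs i)"
    by metis
  \<comment> \<open>A common exponent for all blocks: the sum bounds each of the \<open>m i\<close>.\<close>
  define N where "N = sum m {..<p}"
  have N: "mat_drazin n N (Js i) (JDs i)" if "i < p" for i
  proof -
    have "m i \<le> N" unfolding N_def using that by (intro member_le_sum) auto
    then show ?thesis using mat_drazin_add_exponent[OF m[OF that], of "N - m i"] by simp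
  qed
  have cJD: "JDs i \<in> carrier_mat n n" if "i < p" for i
    using N[OF that] unfolding mat_drazin_iff by blast

  have part1: "is_mat_drazin_inverse (Js i) (JDs i)" if "i < p" for i
    unfolding is_mat_drazin_inverse_iff[OF Js[OF that]]
    by (rule mat_drazin_at_mat_index[OF N[OF that]])

  have "\<exists>JD \<in> tensors n n p. bcirc JD = fourier_block_diag n p JDs"
    using cJD by (rule fourier_block_diag_is_bcirc[OF n p])
  then obtain JD where JD: "JD \<in> tensors n n p" "bcirc JD = fourier_block_diag n p JDs" ..
  have part2: "\<exists>!JD. JD \<in> tensors n n p \<and> bcirc JD = fourier_block_diag n p JDs"
  proof (rule ex1I[of _ JD])
    show "K = JD" if "K \<in> tensors n n p \<and> bcirc K = fourier_block_diag n p JDs" for K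
      using that JD by (intro bcirc_inject[OF n p]) auto
  qed (use JD in blast)

  have unique: "X = Y" if "is_t_drazin_inverse A X" "is_t_drazin_inverse A Y" for X Y
  proof -
    have X: "X \<in> tensors n n p" "mat_drazin (n*p) (t_index A) (bcirc A) (bcirc X)"
      and Y: "Y \<in> tensors n n p" "mat_drazin (n*p) (t_index A) (bcirc A) (bcirc Y)"
      using that unfolding is_t_drazin_inverse_iff[OF n p A] by blast+
    show ?thesis
      by (rule bcirc_inject[OF n p X(1) Y(1) mat_drazin_unique[OF X(2) Y(2)]])
  qed

  have drazin: "is_t_drazin_inverse A (t_inverse P \<star> JD \<star> P)"
    if JD: "JD \<in> tensors n n p" and bJD: "bcirc JD = fourier_block_diag n p JDs" for JD
  proof -
    have "mat_drazin (n*p) N (bcirc (t_inverse P) * bcirc J * bcirc P)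
        (bcirc (t_inverse P) * bcirc JD * bcirc P)"
      unfolding bJ bJD
      using mat_drazin_fourier_block_diag[OF n p, of N Js JDs, OF N]
        bcirc_carrier[OF n p Pi(1)] bcirc_carrier[OF n p P] Pi(2,3)
      by (rule mat_drazin_similar)
    then have "mat_drazin (n*p) N (bcirc A) (bcirc (t_inverse P \<star> JD \<star> P))"
      unfolding APJ bm[OF mult[OF Pi(1) J] P] bm[OF Pi(1) J] bm[OF mult[OF Pi(1) JD] P] bm[OF Pi(1) JD] .
    from mat_drazin_at_mat_index[OF this] show ?thesis
      unfolding is_t_drazin_inverse_iff[OF n p A] t_index_def
      using mult[OF mult[OF Pi(1) JD] P] by blast
  qed
  have the: "t_drazin_inverse A = X" if "is_t_drazin_inverse A X" for X
    unfolding t_drazin_inverse_def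
  proof (rule the_equality[of "is_t_drazin_inverse A", OF that])
    show "Y = X" if "is_t_drazin_inverse A Y" for Y
      using that \<open>is_t_drazin_inverse A X\<close> by (rule unique)
  qed

  have part4: "t_pow A k \<star> X \<star> A = t_pow A k \<and> X \<star> A \<star> X = X \<and> A \<star> X = X \<star> A \<longleftrightarrow>
      X = t_drazin_inverse A" if X: "X \<in> tensors n n p" for X
  proof -
    have eqs: "t_pow A k \<star> X \<star> A = t_pow A k \<and> X \<star> A \<star> X = X \<and> A \<star> X = X \<star> A \<longleftrightarrow>
        is_t_drazin_inverse A X"
      unfolding t_drazin_equations_iff[OF n p A X] is_t_drazin_inverse_iff[OF n p A] assms(6)
      by (simp only: X simp_thms)
    note DX = drazin[OF JD]
    show ?thesis
      unfolding eqs
    proof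
      show "X = t_drazin_inverse A" if "is_t_drazin_inverse A X"
        by (rule the[OF that, symmetric])
      show "is_t_drazin_inverse A X" if "X = t_drazin_inverse A"
        unfolding that the[OF DX] by (rule DX)
    qed
  qed
  show ?thesis
    unfolding JDs_def[symmetric]
  proof (intro conjI allI ballI impI)
    show "is_mat_drazin_inverse (Js i) (partition_drazin (J1 i) (J0 i))" if "i < p" for i
      using part1[OF that] unfolding JDs_def .
    show "\<exists>!JD. JD \<in> tensors n n p \<and> bcirc JD = fourier_block_diag n p JDs"
      by (rule part2)
    show "is_t_drazin_inverse A (t_inverse P \<star> JD \<star> P)"
      if "JD \<in> tensors n n p" "bcirc JD = fourier_block_diag n p JDs" for JD
      using that by (rule drazin)
    then show "t_drazin_inverse A = t_inverse P \<star> JD \<star> P"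
      if "JD \<in> tensors n n p" "bcirc JD = fourier_block_diag n p JDs" for JD
      using that by (intro the)
    show "t_pow A k \<star> X \<star> A = t_pow A k \<and> X \<star> A \<star> X = X \<and> A \<star> X = X \<star> A \<longleftrightarrow>
        X = t_drazin_inverse A" if "X \<in> tensors n n p" for X
      using that by (rule part4)
    show "is_t_group_inverse A X \<longleftrightarrow> t_index A = 1 \<and> is_t_drazin_inverse A X" for X
      by (rule t_group_inverse_iff_index_1[OF n p A])
  qed
qed

end
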